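(* Let $q_c\approx 2.32472$ be the real root of $x^3-3x^2+2x-1=0$. (i) For $q>1$: $\dim_H\mathcal{U}_q>0$ if and only if $q>q_c$. (ii) For any integer $k\ge 2$ and any $q\in\mathcal{B}_k$ we have $\dim_H\mathcal{U}_q^{(k)}=\dim_H\mathcal{U}_q$.
   Context: For a real number $q>1$, a $q$-expansion of a real number $x$ is an infinite sequence $(d_i)_{i\ge1}$ with $d_i\in\{0,1,q\}$ for all $i\ge 1$ and $x=\sum_{i=1}^\infty d_i/q^i$ (the digit set depends on $q$). Let $E_q$ be the set of real numbers having at least one $q$-expansion. For an integer $k\ge 1$, let $\mathcal{B}_k$ be the set of all $q\in(1,\infty)$ for which there exists $x\in E_q$ with precisely $k$ different $q$-expansions, and let $\mathcal{U}_q^{(k)}$ be the set of all $x\in E_q$ having precisely $k$ different $q$-expansions. Write $\mathcal{U}_q:=\mathcal{U}_q^{(1)}$ for the set of $x\in E_q$ with a unique $q$-expansion. $\dim_H$ denotes Hausdorff dimension. *)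

theory Defs
  imports "HOL-Analysis.Analysis"
begin

section \<open>Hausdorff dimension\<close>

text \<open>The summand \<open>diam(U)^s\<close> with the usual conventions \<open>diam(\<emptyset>)^s = 0\<close> and \<open>0^0 = 1\<close> for
  nonempty \<open>U\<close>; the library has \<open>0 powr 0 = 0\<close>.\<close>

definition diam_pow :: "real \<Rightarrow> 'a::metric_space set \<Rightarrow> ennreal" where
  "diam_pow s U =
    (if U = {} then 0 else if s = 0 then 1 else ennreal (diameter U powr s))"

text \<open>Boundedness of the covering sets is required explicitly because \<^const>\<open>diameter\<close> is real-valued
  and carries no information on unbounded sets. Finite covers are included by padding with \<open>{}\<close>.\<close>

definition hausdorff_premeasure :: "real \<Rightarrow> real \<Rightarrow> 'a::metric_space set \<Rightarrow> ennreal" where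
  "hausdorff_premeasure s \<delta> A =
    (INF U \<in> {U :: nat \<Rightarrow> 'a set. A \<subseteq> (\<Union>i. U i) \<and> (\<forall>i. bounded (U i) \<and> diameter (U i) \<le> \<delta>)}.
      (\<Sum>i. diam_pow s (U i)))"

definition hausdorff_measure :: "real \<Rightarrow> 'a::metric_space set \<Rightarrow> ennreal" where
  "hausdorff_measure s A = (SUP \<delta> \<in> {0<..}. hausdorff_premeasure s \<delta> A)"

definition hausdorff_dim :: "'a::metric_space set \<Rightarrow> ennreal" where
  "hausdorff_dim A = (INF s \<in> {s. 0 \<le> s \<and> hausdorff_measure s A = 0}. ennreal s)"

section \<open>Expansions with digits 0, 1, q\<close>

text \<open>Sequences are indexed from 0: \<open>d i\<close> is the digit \<open>d\<^sub>i\<^sub>+\<^sub>1\<close>, with weight \<open>1 / q^(i+1)\<close>.\<close>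

definition q_expansions :: "real \<Rightarrow> real \<Rightarrow> (nat \<Rightarrow> real) set" where
  "q_expansions q x = {d. (\<forall>i. d i \<in> {0, 1, q}) \<and> (\<lambda>i. d i / q ^ Suc i) sums x}"

definition E_set :: "real \<Rightarrow> real set" where
  "E_set q = {x. q_expansions q x \<noteq> {}}"

text \<open>For \<open>k \<ge> 1\<close> the equation \<open>card S = k\<close> forces \<open>S\<close> to be finite, so it says that there are exactly
  \<open>k\<close> expansions. (For \<open>k = 0\<close> it would also admit infinite \<open>S\<close>; that value is not used.)\<close>

definition U_k :: "nat \<Rightarrow> real \<Rightarrow> real set" where
  "U_k k q = {x \<in> E_set q. card (q_expansions q x) = k}"

definition U_set :: "real \<Rightarrow> real set" where
  "U_set q = U_k 1 q"

definition B_set :: "nat \<Rightarrow> real set" where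
  "B_set k = {q. 1 < q \<and> (\<exists>x \<in> E_set q. card (q_expansions q x) = k)}"

definition q_c :: real where
  "q_c = (THE x. x ^ 3 - 3 * x ^ 2 + 2 * x - 1 = 0)"

lemma q_c_ex1: "\<exists>!x::real. x ^ 3 - 3 * x ^ 2 + 2 * x - 1 = 0"
  and q_c_approx: "2.32471 < q_c" "q_c < 2.32472"
proof -
  let ?f = "\<lambda>x::real. x ^ 3 - 3 * x ^ 2 + 2 * x - 1"
  have "\<exists>x\<ge>2.32471. x \<le> 2.32472 \<and> ?f x = 0"
    by (rule IVT') (auto intro!: continuous_intros simp: power2_eq_square power3_eq_cube)
  then obtain x where x: "2.32471 \<le> x" "x \<le> 2.32472" "?f x = 0" by blast
  have uniq: "y = x" if y: "?f y = 0" for y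
  proof (rule ccontr)
    assume "y \<noteq> x"
    have "(y - x) * (y\<^sup>2 + (x - 3) * y + (x\<^sup>2 - 3 * x + 2)) = ?f y - ?f x"
      by (simp add: power2_eq_square power3_eq_cube algebra_simps)
    with y x(3) \<open>y \<noteq> x\<close> have quad: "y\<^sup>2 + (x - 3) * y + (x\<^sup>2 - 3 * x + 2) = 0" by simp
    have "(2 * y + x - 3)\<^sup>2
        = 4 * (y\<^sup>2 + (x - 3) * y + (x\<^sup>2 - 3 * x + 2)) + 4 - 3 * (x - 1)\<^sup>2"
      by (simp add: power2_eq_square algebra_simps)
    with quad have "(2 * y + x - 3)\<^sup>2 = 4 - 3 * (x - 1)\<^sup>2" by simp
    moreover have "1.3\<^sup>2 \<le> (x - 1)\<^sup>2"
      using x(1) by (intro power_mono) auto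
    ultimately have "(2 * y + x - 3)\<^sup>2 < 0" by (simp add: power2_eq_square)
    then show False using zero_le_power2[of "2 * y + x - 3"] by linarith
  qed
  show "\<exists>!x. ?f x = 0" using x(3) uniq by blast
  have "q_c = x" unfolding q_c_def using x(3) uniq by (rule the_equality)
  moreover have "?f 2.32471 \<noteq> 0" "?f 2.32472 \<noteq> 0"
    by (simp_all add: power2_eq_square power3_eq_cube)
  then have "x \<noteq> 2.32471" "x \<noteq> 2.32472" using x(3) by blast+
  ultimately show "2.32471 < q_c" "q_c < 2.32472" using x by auto
qed

end

theory Submission
  imports Defs
begin

text \<open>The words \<open>10\<close> and \<open>0q\<close> have the same value, so neither occurs in a unique expansion. Hence, up
  to a finite prefix, a point of \<open>U_set q\<close> is \<open>0\<close>, \<open>q / (q - 1)\<close>, or an element of the set \<open>A\<close> of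
  points with a unique expansion that starts with \<open>1\<close>.

  The cubic is \<open>q (q - 1) (q - 2) - 1\<close>. If it is nonpositive then \<open>A\<close> is empty, so \<open>U_set q\<close> is countable.
  If it is positive then all expansions with digits \<open>1\<close> and \<open>q\<close>, infinitely many \<open>q\<close>s and sufficiently
  long gaps between them are unique; reading off binary digits from them maps a subset of
  \<open>U_set q\<close> onto \<open>[0, 1]\<close> by a Hoelder map, which gives positive dimension.

  For the multiple expansions, a point with \<open>k\<close> expansions has a tail with a unique one, so \<open>U_k k q\<close> is
  covered by countably many similar copies of \<open>U_set q\<close>. Conversely, for \<open>y \<in> A\<close> the point with
  expansion \<open>1 0 q\<^sup>k\<^sup>-\<^sup>2 y\<close> has exactly \<open>k\<close> expansions, obtained by successive replacements of \<open>10\<close> by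
  \<open>0q\<close> and of \<open>0q\<close> by \<open>10\<close>, so \<open>U_k k q\<close> contains a similar copy of \<open>A\<close>.\<close>

section \<open>Sets of Hausdorff measure zero\<close>

text \<open>This criterion replaces the supremum of infima in all later arguments, which only ask
  whether a measure vanishes.\<close>

lemma hausdorff_measure_eq_0_iff:
  "hausdorff_measure s A = 0 \<longleftrightarrow>
    (\<forall>\<delta>>0. \<forall>\<epsilon>>0. \<exists>U. A \<subseteq> (\<Union>i. U i) \<and> (\<forall>i. bounded (U i) \<and> diameter (U i) \<le> \<delta>) \<and>
      (\<Sum>i. diam_pow s (U i)) < \<epsilon>)"
proof -
  have "x = 0 \<longleftrightarrow> (\<forall>\<epsilon>>0. x < \<epsilon>)" for x :: ennreal
    by (metis less_irrefl not_gr_zero)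
  then have "hausdorff_measure s A = 0 \<longleftrightarrow> (\<forall>\<delta>>0. \<forall>\<epsilon>>0. hausdorff_premeasure s \<delta> A < \<epsilon>)"
    unfolding hausdorff_measure_def bot_ennreal[symmetric] SUP_bot_conv by auto
  then show ?thesis
    unfolding hausdorff_premeasure_def INF_less_iff by auto
qed

lemma hausdorff_measure_0_mono:
  assumes "hausdorff_measure s B = 0" "A \<subseteq> B"
  shows "hausdorff_measure s A = 0"
  using assms unfolding hausdorff_measure_eq_0_iff by (meson order_trans)

lemma hausdorff_measure_0_UN:
  fixes A :: "nat \<Rightarrow> 'a::metric_space set"
  assumes null: "\<And>n. hausdorff_measure s (A n) = 0"
  shows "hausdorff_measure s (\<Union>n. A n) = 0"
  unfolding hausdorff_measure_eq_0_iff
proof (intro allI impI)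
  fix \<delta> :: real and \<epsilon> :: ennreal assume "\<delta> > 0" "\<epsilon> > 0"
  \<comment> \<open>Summing the shares \<open>e / 2 ^ (n + 1)\<close> gives only a bound by
    \<open>e\<close>, so \<open>e\<close> is chosen strictly below \<epsilon>.\<close>
  obtain e where e: "0 < e" "e < \<epsilon>"
    using dense[OF \<open>\<epsilon> > 0\<close>] by blast
  have pos: "e * ennreal ((1/2) ^ Suc n) > 0" for n
    using e(1) by (simp add: ennreal_zero_less_mult_iff del: power_Suc)
  have "\<forall>n. \<exists>U. A n \<subseteq> (\<Union>i. U i) \<and> (\<forall>i. bounded (U i) \<and> diameter (U i) \<le> \<delta>) \<and>
      (\<Sum>i. diam_pow s (U i)) < e * ennreal ((1/2) ^ Suc n)"
    using null \<open>\<delta> > 0\<close> pos unfolding hausdorff_measure_eq_0_iff by blast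
  then obtain U where U: "\<And>n. A n \<subseteq> (\<Union>i. U n i)" "\<And>n i. bounded (U n i)"
      "\<And>n i. diameter (U n i) \<le> \<delta>" "\<And>n. (\<Sum>i. diam_pow s (U n i)) < e * ennreal ((1/2) ^ Suc n)"
    by metis
  \<comment> \<open>The doubly indexed cover is enumerated as one sequence, which leaves its total
    unchanged.\<close>
  define V where "V = (\<lambda>m. case_prod U (prod_decode m))"
  have "(\<Sum>m. diam_pow s (V m)) = (\<Sum>n. \<Sum>i. diam_pow s (U n i))"
    unfolding V_def
    by (subst suminf_ennreal_2dimen[where f="\<lambda>p. diam_pow s (case_prod U p)" and
          g = "\<lambda>n. (\<Sum>i. diam_pow s (U n i))", symmetric]) (auto simp: o_def)
  also have "\<dots> \<le> (\<Sum>n. e * ennreal ((1/2) ^ Suc n))"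
    using U(4) by (intro suminf_le) (auto intro: less_imp_le)
  also have "\<dots> = e"
    unfolding ennreal_suminf_cmult
    by (subst suminf_ennreal_eq[OF _ power_half_series]) auto
  finally have "(\<Sum>m. diam_pow s (V m)) < \<epsilon>" using e by simp
  moreover have "(\<Union>n. A n) \<subseteq> (\<Union>m. V m)"
  proof
    fix x assume "x \<in> (\<Union>n. A n)"
    then obtain n i where "x \<in> U n i" using U(1) by blast
    then have "x \<in> V (prod_encode (n, i))" by (simp add: V_def)
    then show "x \<in> (\<Union>m. V m)" by blast
  qed
  moreover have "bounded (V m) \<and> diameter (V m) \<le> \<delta>" for m
    using U(2,3) by (simp add: V_def split: prod.split)
  ultimately show "\<exists>V. (\<Union>n. A n) \<subseteq> (\<Union>i. V i) \<and> (\<forall>i. bounded (V i) \<and> diameter (V i) \<le> \<delta>) \<and>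
      (\<Sum>i. diam_pow s (V i)) < \<epsilon>" by blast
qed

lemma hausdorff_measure_0_empty: "hausdorff_measure s {} = 0"
  unfolding hausdorff_measure_eq_0_iff
  by (intro allI impI exI[of _ "\<lambda>_. {}"]) (auto simp: diam_pow_def)

lemma hausdorff_measure_0_singleton:
  assumes "s > 0" shows "hausdorff_measure s {x} = 0"
  unfolding hausdorff_measure_eq_0_iff
  using assms by (intro allI impI exI[of _ "\<lambda>_. {x}"]) (auto simp: diam_pow_def)

lemma hausdorff_measure_0_Un:
  assumes "hausdorff_measure s A = 0" "hausdorff_measure s B = 0"
  shows "hausdorff_measure s (A \<union> B) = 0"
proof -
  have "hausdorff_measure s (\<Union>n::nat. if n = 0 then A else B) = 0"
    using assms by (intro hausdorff_measure_0_UN) auto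
  moreover have "A \<union> B \<subseteq> (\<Union>n::nat. if n = 0 then A else B)"
    using UN_upper[of "0::nat" UNIV "\<lambda>n. if n = 0 then A else B"]
      UN_upper[of "1::nat" UNIV "\<lambda>n. if n = 0 then A else B"] by simp
  ultimately show ?thesis by (rule hausdorff_measure_0_mono)
qed

lemma hausdorff_measure_0_lipschitz_image:
  fixes f :: "'a::metric_space \<Rightarrow> 'b::metric_space"
  assumes "s > 0" "L-lipschitz_on A f" "hausdorff_measure s A = 0"
  shows "hausdorff_measure s (f ` A) = 0"
  unfolding hausdorff_measure_eq_0_iff
proof (intro allI impI)
  fix \<delta> :: real and \<epsilon> :: ennreal assume \<delta>: "\<delta> > 0" and \<epsilon>: "\<epsilon> > 0"
  \<comment> \<open>\<open>L + 1\<close> is positive even for \<open>L = 0\<close>, so the mesh and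
    the total size can be divided by it.\<close>
  define M where "M = L + 1"
  have "L \<ge> 0" using assms(2) by (rule lipschitz_on_nonneg)
  then have M: "M > 0" "L \<le> M" by (auto simp: M_def)
  have f: "dist (f x) (f y) \<le> M * dist x y" if "x \<in> A" "y \<in> A" for x y
    using lipschitz_onD[OF assms(2) that] M by (meson mult_right_mono order_trans zero_le_dist)
  obtain e where e: "0 < e" "e < \<epsilon>"
    using dense[OF \<epsilon>] by blast
  have "e / ennreal (M powr s) > 0"
    using e by (simp add: ennreal_zero_less_divide)
  moreover have "\<delta> / M > 0" using \<delta> M by simp
  ultimately obtain U where U: "A \<subseteq> (\<Union>i. U i)" "\<And>i. bounded (U i)" "\<And>i. diameter (U i) \<le> \<delta> / M"
      "(\<Sum>i. diam_pow s (U i)) < e / ennreal (M powr s)"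
    using assms(3)[unfolded hausdorff_measure_eq_0_iff, rule_format,
        of "\<delta> / M" "e / ennreal (M powr s)"] by blast
  \<comment> \<open>The Lipschitz bound holds on \<open>A\<close> only, hence the
    intersection.\<close>
  define V where "V = (\<lambda>i. f ` (U i \<inter> A))"
  have bnd: "dist a b \<le> M * diameter (U i)" if ab: "a \<in> V i" "b \<in> V i" for a b i
  proof -
    obtain x y where xy: "x \<in> U i" "y \<in> U i" "x \<in> A" "y \<in> A" "a = f x" "b = f y"
      using ab unfolding V_def by blast
    have "dist x y \<le> diameter (U i)" using U(2) xy by (intro diameter_bounded_bound) auto
    then show ?thesis
      using f[of x y] xy M by (meson mult_left_mono less_imp_le order_trans)
  qed
  have V: "bounded (V i)" "diameter (V i) \<le> M * diameter (U i)" for i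
  proof -
    show "bounded (V i)" using bnd[of _ i] unfolding bounded_two_points by blast
    show "diameter (V i) \<le> M * diameter (U i)"
      using bnd[of _ i] M diameter_ge_0[OF U(2)[of i]]
      unfolding diameter_def[of "V i"] by (auto intro!: cSUP_least)
  qed
  have "diam_pow s (V i) \<le> ennreal (M powr s) * diam_pow s (U i)" for i
  proof (cases "V i = {}")
    case False
    then have "U i \<noteq> {}" by (auto simp: V_def)
    have "diameter (V i) powr s \<le> (M * diameter (U i)) powr s"
      using V(2)[of i] diameter_ge_0[OF V(1)[of i]] assms(1) by (intro powr_mono2) auto
    also have "\<dots> = M powr s * diameter (U i) powr s"
      using M diameter_ge_0[OF U(2)[of i]] by (simp add: powr_mult)
    finally show ?thesis
      using False \<open>U i \<noteq> {}\<close> assms(1)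
      by (simp add: diam_pow_def ennreal_leI flip: ennreal_mult'')
  qed (simp add: diam_pow_def)
  then have "(\<Sum>i. diam_pow s (V i)) \<le> (\<Sum>i. ennreal (M powr s) * diam_pow s (U i))"
    by (intro suminf_le) auto
  also have "\<dots> = ennreal (M powr s) * (\<Sum>i. diam_pow s (U i))" by simp
  also have "\<dots> \<le> ennreal (M powr s) * (e / ennreal (M powr s))"
    using U(4) by (intro mult_left_mono) auto
  also have "\<dots> = e"
    using M by (simp add: ennreal_times_divide ennreal_mult_divide_eq mult.commute)
  finally have "(\<Sum>i. diam_pow s (V i)) < \<epsilon>" using e by simp
  moreover have "f ` A \<subseteq> (\<Union>i. V i)" using U(1) unfolding V_def by blast
  moreover have "diameter (V i) \<le> \<delta>" for i
  proof -
    have "diameter (V i) \<le> M * (\<delta> / M)"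
      using V(2)[of i] mult_left_mono[OF U(3)[of i], of M] M by linarith
    then show ?thesis using M by simp
  qed
  ultimately show "\<exists>V. f ` A \<subseteq> (\<Union>i. V i) \<and> (\<forall>i. bounded (V i) \<and> diameter (V i) \<le> \<delta>) \<and>
      (\<Sum>i. diam_pow s (V i)) < \<epsilon>" using V(1) by blast
qed

section \<open>From null sets to the dimension\<close>

text \<open>With exponent 0 every nonempty covering set contributes 1, so no cover of a nonempty set
  has total below 1.\<close>

lemma hausdorff_measure_0_zero_exponent:
  assumes "hausdorff_measure 0 A = 0" shows "A = {}"
proof (rule ccontr)
  assume "A \<noteq> {}"
  have "\<exists>U. A \<subseteq> (\<Union>i. U i) \<and> (\<Sum>i. diam_pow 0 (U i)) < 1"
    using assms zero_less_one unfolding hausdorff_measure_eq_0_iff by metis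
  then obtain U where U: "A \<subseteq> (\<Union>i. U i)" "(\<Sum>i. diam_pow 0 (U i)) < 1"
    by blast
  obtain i where "U i \<noteq> {}" using U(1) \<open>A \<noteq> {}\<close> by blast
  then have "1 = diam_pow 0 (U i)" by (simp add: diam_pow_def)
  also have "\<dots> \<le> (\<Sum>i. diam_pow 0 (U i))"
    using sum_le_suminf[of "\<lambda>i. diam_pow 0 (U i)" "{i}"] by simp
  finally show False using U(2) by simp
qed

lemma hausdorff_dim_eq_0:
  assumes "\<And>s. s > 0 \<Longrightarrow> hausdorff_measure s A = 0"
  shows "hausdorff_dim A = 0"
proof -
  have "hausdorff_dim A \<le> 0"
  proof (rule ennreal_le_epsilon)
    fix e :: real assume "e > 0"
    then show "hausdorff_dim A \<le> 0 + ennreal e"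
      unfolding hausdorff_dim_def using assms by (intro INF_lower2[of e]) auto
  qed
  then show ?thesis by simp
qed

text \<open>Positive exponents decide the comparison: for nonempty \<open>B\<close> the exponent 0
  never gives measure zero, and for empty \<open>B\<close> the assumption makes \<open>A\<close>
  null at every positive exponent.\<close>

lemma hausdorff_dim_le:
  assumes "\<And>s. s > 0 \<Longrightarrow> hausdorff_measure s B = 0 \<Longrightarrow> hausdorff_measure s A = 0"
  shows "hausdorff_dim A \<le> hausdorff_dim B"
proof (cases "B = {}")
  case True
  then have "hausdorff_dim A = 0"
    using assms hausdorff_measure_0_empty by (intro hausdorff_dim_eq_0) auto
  then show ?thesis by simp
next
  case False
  show ?thesis unfolding hausdorff_dim_def
  proof (rule INF_greatest)
    fix s assume s: "s \<in> {s. 0 \<le> s \<and> hausdorff_measure s B = 0}"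
    then have "s \<noteq> 0" using False hausdorff_measure_0_zero_exponent by blast
    then have "s > 0" using s by simp
    then have "s \<in> {s. 0 \<le> s \<and> hausdorff_measure s A = 0}" using assms s by auto
    then show "(INF s\<in>{s. 0 \<le> s \<and> hausdorff_measure s A = 0}. ennreal s) \<le> ennreal s"
      by (rule INF_lower)
  qed
qed

text \<open>The correspondence from \<open>X b\<close> to \<open>T b\<close> is Hoelder with
  exponent \<open>s\<close>, so a cover of \<open>A\<close> by sets \<open>U i\<close> turns into a
  cover of the unit interval by intervals of length \<open>2 * C * diameter (U i) powr s\<close>.
  Comparing lengths bounds the total size of the cover below by \<open>1 / (2 * C)\<close>.\<close>

lemma hausdorff_measure_pos_if_hoelder_onto:
  fixes X :: "'b \<Rightarrow> 'a::metric_space" and T :: "'b \<Rightarrow> real"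
  assumes s: "s > 0" and C: "C > 0" and X: "range X \<subseteq> A" and T: "{0..1} \<subseteq> range T"
    and hoelder: "\<And>b b'. \<bar>T b - T b'\<bar> \<le> C * dist (X b) (X b') powr s"
  shows "hausdorff_measure s A \<noteq> 0"
proof
  assume null: "hausdorff_measure s A = 0"
  \<comment> \<open>Half of the lower bound \<open>1 / (2 * C)\<close> that every cover has to
    meet.\<close>
  have "ennreal (1 / (4 * C)) > 0" using C by simp
  then obtain U where U: "A \<subseteq> (\<Union>i. U i)" "\<And>i. bounded (U i)"
      "(\<Sum>i. diam_pow s (U i)) < ennreal (1 / (4 * C))"
    using null zero_less_one unfolding hausdorff_measure_eq_0_iff by metis
  \<comment> \<open>\<open>c i\<close> is the value of \<open>T\<close> at one chosen parameter
    whose point lies in \<open>U i\<close>; the interval \<open>V i\<close> around it contains the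
    values at all such parameters and is measurable.\<close>
  define c where "c = (\<lambda>i. T (SOME b. X b \<in> U i))"
  define V where "V = (\<lambda>i. if \<exists>b. X b \<in> U i
    then {c i - C * diameter (U i) powr s..c i + C * diameter (U i) powr s} else {})"
  have "range T \<subseteq> (\<Union>i. V i)"
  proof
    fix t assume "t \<in> range T"
    then obtain b where b: "t = T b" by blast
    obtain i where i: "X b \<in> U i" using X U(1) by blast
    define b' where "b' = (SOME b. X b \<in> U i)"
    have b': "X b' \<in> U i" unfolding b'_def using i by (rule someI)
    have "\<bar>T b - T b'\<bar> \<le> C * dist (X b) (X b') powr s" by (rule hoelder)
    also have "\<dots> \<le> C * diameter (U i) powr s"
      using s C b' i U(2)[of i]
      by (intro mult_left_mono powr_mono2 diameter_bounded_bound) auto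
    finally have "T b \<in> V i" using i by (auto simp: V_def c_def b'_def)
    then show "t \<in> (\<Union>i. V i)" using b by blast
  qed
  with T have "{0..1} \<subseteq> (\<Union>i. V i)" by (rule order_trans)
  then have "emeasure lborel {0..1::real} \<le> emeasure lborel (\<Union>i. V i)"
    by (intro emeasure_mono) (auto simp: V_def)
  also have "\<dots> \<le> (\<Sum>i. emeasure lborel (V i))"
    by (intro emeasure_subadditive_countably) (auto simp: V_def)
  also have "\<dots> \<le> (\<Sum>i. ennreal (2 * C) * diam_pow s (U i))"
  proof (intro suminf_le)
    fix i
    show "emeasure lborel (V i) \<le> ennreal (2 * C) * diam_pow s (U i)"
    proof (cases "\<exists>b. X b \<in> U i")
      case True
      then have "U i \<noteq> {}" by blast
      with True show ?thesis using C s
        by (simp add: V_def diam_pow_def flip: ennreal_mult)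
    qed (simp add: V_def)
  qed auto
  also have "\<dots> = ennreal (2 * C) * (\<Sum>i. diam_pow s (U i))" by simp
  also have "\<dots> \<le> ennreal (2 * C) * ennreal (1 / (4 * C))"
    using U(3) by (intro mult_left_mono) auto
  also have "\<dots> = ennreal (1 / 2)" using C by (simp flip: ennreal_mult)
  finally have "ennreal 1 \<le> ennreal (1 / 2)" by simp
  then show False by (subst (asm) ennreal_le_iff) auto
qed

section \<open>Expansions in a real base\<close>

definition expansion_value :: "real \<Rightarrow> (nat \<Rightarrow> real) \<Rightarrow> real" where
  "expansion_value \<beta> d = (\<Sum>i. d i / \<beta> ^ Suc i)"

lemma sums_const_expansion:
  fixes \<beta> :: real assumes "\<beta> > 1"
  shows "(\<lambda>i. c / \<beta> ^ Suc i) sums (c / (\<beta> - 1))"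
proof -
  have "(\<lambda>i. (c / \<beta>) * (1 / \<beta>) ^ i) sums ((c / \<beta>) * (1 / (1 - 1 / \<beta>)))"
    using assms by (intro sums_mult geometric_sums) simp
  moreover have "\<beta> * (1 - 1 / \<beta>) = \<beta> - 1"
    using assms by (simp add: right_diff_distrib)
  then have "(c / \<beta>) * (1 / (1 - 1 / \<beta>)) = c / (\<beta> - 1)"
    by (metis mult.right_neutral times_divide_times_eq)
  moreover have "(c / \<beta>) * (1 / \<beta>) ^ i = c / \<beta> ^ Suc i" for i
    by (simp add: power_divide)
  ultimately show ?thesis by (simp only:)
qed

lemma summable_expansion:
  fixes \<beta> :: real assumes "\<beta> > 1" "\<And>i. \<bar>d i\<bar> \<le> M"
  shows "summable (\<lambda>i. d i / \<beta> ^ Suc i)"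
proof (rule summable_comparison_test'[where N = 0])
  show "summable (\<lambda>i. M / \<beta> ^ Suc i)"
    using sums_const_expansion[OF assms(1)] by (rule sums_summable)
  show "norm (d n / \<beta> ^ Suc n) \<le> M / \<beta> ^ Suc n" for n
    using assms by (simp add: abs_mult divide_right_mono del: power_Suc)
qed

lemma sums_expansion_Suc_iff:
  fixes \<beta> :: real assumes "\<beta> > 1"
  shows "(\<lambda>i. d (Suc i) / \<beta> ^ Suc i) sums (\<beta> * x - d 0) \<longleftrightarrow> (\<lambda>i. d i / \<beta> ^ Suc i) sums x"
proof -
  have "(\<lambda>i. d i / \<beta> ^ Suc i) sums x \<longleftrightarrow> (\<lambda>i. d (Suc i) / \<beta> ^ Suc (Suc i)) sums (x - d 0 / \<beta>)"
    using sums_Suc_iff[of "\<lambda>i. d i / \<beta> ^ Suc i" "x - d 0 / \<beta>"] by simp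
  also have "\<dots> \<longleftrightarrow> (\<lambda>i. \<beta> * (d (Suc i) / \<beta> ^ Suc (Suc i))) sums (\<beta> * (x - d 0 / \<beta>))"
    using assms by (intro sums_mult_iff[symmetric]) simp
  finally show ?thesis using assms by (simp add: algebra_simps)
qed

lemma sums_expansion_value:
  assumes "\<beta> > 1" "\<And>i. \<bar>d i\<bar> \<le> M"
  shows "(\<lambda>i. d i / \<beta> ^ Suc i) sums expansion_value \<beta> d"
  unfolding expansion_value_def using summable_expansion[OF assms] by (rule summable_sums)

lemma expansion_value_Suc:
  assumes "\<beta> > 1" "\<And>i. \<bar>d i\<bar> \<le> M"
  shows "expansion_value \<beta> d = (d 0 + expansion_value \<beta> (\<lambda>i. d (Suc i))) / \<beta>"
proof -
  have "(\<lambda>i. d (Suc i) / \<beta> ^ Suc i) sums (\<beta> * expansion_value \<beta> d - d 0)"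
    using sums_expansion_value[of \<beta> d, OF assms] assms(1) by (simp only: sums_expansion_Suc_iff)
  then have "expansion_value \<beta> (\<lambda>i. d (Suc i)) = \<beta> * expansion_value \<beta> d - d 0"
    unfolding expansion_value_def by (rule sums_unique[symmetric])
  then show ?thesis using assms(1) by simp
qed

lemma expansion_value_split:
  assumes "\<beta> > 1" "\<And>i. \<bar>d i\<bar> \<le> M"
  shows "expansion_value \<beta> d =
    (\<Sum>i<n. d i / \<beta> ^ Suc i) + expansion_value \<beta> (\<lambda>i. d (i + n)) / \<beta> ^ n"
proof (induction n)
  case (Suc n)
  have "expansion_value \<beta> (\<lambda>i. d (i + n)) = (d n + expansion_value \<beta> (\<lambda>i. d (i + Suc n))) / \<beta>"
    using expansion_value_Suc[of \<beta> "\<lambda>i. d (i + n)" M] assms by simp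
  then show ?case using assms(1) Suc by (simp add: field_simps)
qed simp

lemma sums_expansion_bounds:
  fixes \<beta> :: real
  assumes "\<beta> > 1" "(\<lambda>i. d i / \<beta> ^ Suc i) sums x" "\<And>i. a \<le> d i" "\<And>i. d i \<le> b"
  shows "a / (\<beta> - 1) \<le> x" "x \<le> b / (\<beta> - 1)"
  using assms
  by (auto intro!: sums_le[OF _ sums_const_expansion assms(2)] sums_le[OF _ assms(2) sums_const_expansion]
      divide_right_mono)

text \<open>\<open>Y n / \<beta> ^ n\<close> is the remainder after \<open>n\<close> digits: the
  partial sums telescope, and boundedness of the orbit sends the remainder to 0.\<close>

lemma sums_expansion_orbit:
  fixes \<beta> :: real and Y :: "nat \<Rightarrow> real"
  assumes "\<beta> > 1" "\<And>n. \<bar>Y n\<bar> \<le> M" "\<And>n. Y (Suc n) = \<beta> * Y n - d n"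
  shows "(\<lambda>i. d i / \<beta> ^ Suc i) sums Y 0"
proof -
  have partial: "(\<Sum>i<n. d i / \<beta> ^ Suc i) = Y 0 - Y n / \<beta> ^ n" for n
  proof (induction n)
    case (Suc n)
    have "\<beta> * \<beta> ^ n \<noteq> 0" using assms(1) by simp
    then have "Y n / \<beta> ^ n = d n / \<beta> ^ Suc n + Y (Suc n) / \<beta> ^ Suc n"
      using assms(1) by (simp add: assms(3) diff_divide_distrib)
    then show ?case using Suc by simp
  qed simp
  have "(\<lambda>n. M * (1 / \<beta>) ^ n) \<longlonglongrightarrow> M * 0"
    using assms(1) by (intro tendsto_mult tendsto_const LIMSEQ_power_zero) simp
  then have "(\<lambda>n. M / \<beta> ^ n) \<longlonglongrightarrow> 0" by (simp add: power_divide)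
  moreover have "norm (Y n / \<beta> ^ n) \<le> M / \<beta> ^ n" for n
    using assms(1,2) by (simp add: divide_right_mono)
  ultimately have "(\<lambda>n. Y n / \<beta> ^ n) \<longlonglongrightarrow> 0"
    by (rule Lim_null_comparison[OF always_eventually[OF allI], rotated])
  then have "(\<lambda>n. Y 0 - Y n / \<beta> ^ n) \<longlonglongrightarrow> Y 0 - 0" by (intro tendsto_diff tendsto_const)
  then show ?thesis unfolding sums_def partial by simp
qed

text \<open>Choosing at each point a digit that keeps the orbit inside \<open>S\<close> yields a
  bounded orbit, and the chosen digits form an expansion.\<close>

lemma expansion_exists:
  fixes \<beta> :: real
  assumes "\<beta> > 1" "bounded S" "x \<in> S" and step: "\<And>y. y \<in> S \<Longrightarrow> \<exists>c\<in>D. \<beta> * y - c \<in> S"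
  shows "\<exists>d. (\<forall>i. d i \<in> D) \<and> (\<lambda>i. d i / \<beta> ^ Suc i) sums x"
proof -
  obtain g where g: "\<And>y. y \<in> S \<Longrightarrow> g y \<in> D \<and> \<beta> * y - g y \<in> S"
    using step by metis
  define Y where "Y = (\<lambda>n. ((\<lambda>y. \<beta> * y - g y) ^^ n) x)"
  have Y: "Y n \<in> S" for n
    by (induction n) (use assms(3) g in \<open>auto simp: Y_def\<close>)
  obtain M where "\<And>y. y \<in> S \<Longrightarrow> \<bar>y\<bar> \<le> M"
    using assms(2) by (auto simp: bounded_iff)
  then have "(\<lambda>i. g (Y i) / \<beta> ^ Suc i) sums Y 0"
    using Y by (intro sums_expansion_orbit[OF assms(1)]) (auto simp: Y_def)
  then show ?thesis
    using Y g by (intro exI[of _ "\<lambda>i. g (Y i)"]) (auto simp: Y_def)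
qed

section \<open>Unique expansions with digits 0, 1, q\<close>

text \<open>Equality with \<open>{d}\<close> carries the digit condition and the convergence for
  \<open>d\<close> along with uniqueness.\<close>

definition unique_digits :: "real \<Rightarrow> (nat \<Rightarrow> real) \<Rightarrow> bool" where
  "unique_digits q d \<longleftrightarrow> q_expansions q (expansion_value q d) = {d}"

text \<open>This is the set \<open>A\<close> of the overview.\<close>

definition univoque_first_one :: "real \<Rightarrow> real set" where
  "univoque_first_one q = expansion_value q ` {d. unique_digits q d \<and> d 0 = 1}"

text \<open>The n-th step of the iterated function system of the three digits, applied to
  \<open>B\<close>. It expresses "in \<open>B\<close> up to a prefix of length \<open>n\<close>" as
  a finite union of similar copies.\<close>

primrec prefixed :: "real \<Rightarrow> nat \<Rightarrow> real set \<Rightarrow> real set" where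
  "prefixed q 0 B = B"
| "prefixed q (Suc n) B = (\<Union>c\<in>{0, 1, q}. (\<lambda>y. (c + y) / q) ` prefixed q n B)"

lemma q_expansions_value:
  assumes "d \<in> q_expansions q x" shows "expansion_value q d = x"
  using assms unfolding q_expansions_def expansion_value_def by (auto dest: sums_unique)

lemma q_expansions_digit:
  assumes "d \<in> q_expansions q x" shows "d i \<in> {0, 1, q}"
  using assms unfolding q_expansions_def by blast

lemma U_set_eq: "U_set q = {x. \<exists>d. q_expansions q x = {d}}"
  unfolding U_set_def U_k_def E_set_def One_nat_def card_1_singleton_iff by auto

lemma U_set_eq_image: "U_set q = expansion_value q ` {d. unique_digits q d}"
  unfolding U_set_eq unique_digits_def
  using q_expansions_value by (auto simp: image_iff) (metis insertI1)

lemma unique_digits_mem: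
  "unique_digits q d \<Longrightarrow> d \<in> q_expansions q (expansion_value q d)"
  by (simp add: unique_digits_def)

lemma unique_digits_eqI:
  "unique_digits q d \<Longrightarrow> e \<in> q_expansions q (expansion_value q d) \<Longrightarrow> e = d"
  by (simp add: unique_digits_def)

lemma inj_case_nat: "inj_on (case_nat c :: (nat \<Rightarrow> 'a) \<Rightarrow> _) S"
  by (rule inj_onI) (metis nat.simps(5) ext)

lemma case_nat_shift: "case_nat (d 0) (\<lambda>i. d (Suc i)) = d"
  by (auto split: nat.split)

lemma hausdorff_measure_0_prefixed:
  assumes "s > 0" "hausdorff_measure s B = 0"
  shows "hausdorff_measure s (prefixed q n B) = 0"
proof (induction n)
  case (Suc n)
  have "hausdorff_measure s ((\<lambda>y. (c + y) / q) ` prefixed q n B) = 0" for c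
    using Suc by (intro hausdorff_measure_0_lipschitz_image[OF \<open>s > 0\<close>, of "\<bar>1 / q\<bar>"] lipschitz_onI)
      (auto simp: dist_real_def diff_divide_distrib[symmetric] abs_divide)
  from this[of 0] this[of 1] this[of q] show ?case
    by (simp add: hausdorff_measure_0_Un)
qed (use assms in simp)

section \<open>The shift on expansions and the range of values\<close>

context
  fixes q :: real
  assumes q: "q > 1"
begin

lemma q_expansions_Suc:
  assumes "d \<in> q_expansions q x"
  shows "(\<lambda>i. d (Suc i)) \<in> q_expansions q (q * x - d 0)"
  using assms sums_expansion_Suc_iff[OF q, of d x] unfolding q_expansions_def by blast

lemma q_expansions_Cons:
  assumes "c \<in> {0, 1, q}" "e \<in> q_expansions q (q * x - c)"
  shows "case_nat c e \<in> q_expansions q x"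
  using assms sums_expansion_Suc_iff[OF q, of "case_nat c e" x] unfolding q_expansions_def
  by (auto split: nat.split)

lemma q_expansions_unfold:
  "q_expansions q x = (\<Union>c\<in>{0, 1, q}. case_nat c ` q_expansions q (q * x - c))"
proof (intro equalityI subsetI)
  fix d assume d: "d \<in> q_expansions q x"
  have "d = case_nat (d 0) (\<lambda>i. d (Suc i))" by (simp add: case_nat_shift)
  then show "d \<in> (\<Union>c\<in>{0, 1, q}. case_nat c ` q_expansions q (q * x - c))"
    using q_expansions_Suc[OF d] q_expansions_digit[OF d, of 0] by blast
qed (use q_expansions_Cons in blast)

lemma q_expansions_bounds:
  assumes "q_expansions q x \<noteq> {}"
  shows "0 \<le> x" "x \<le> q / (q - 1)"
proof -
  obtain d where "\<And>i. d i \<in> {0, 1, q}" "(\<lambda>i. d i / q ^ Suc i) sums x"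
    using assms unfolding q_expansions_def by blast
  moreover from this have "0 \<le> d i" "d i \<le> q" for i
    using q by (metis empty_iff insert_iff less_eq_real_def order_trans zero_le_one)+
  ultimately show "0 \<le> x" "x \<le> q / (q - 1)"
    using sums_expansion_bounds[OF q, of d x 0 q] by auto
qed

lemma q_expansions_const:
  assumes "c \<in> {0, 1, q}" shows "(\<lambda>_. c) \<in> q_expansions q (c / (q - 1))"
  using assms sums_const_expansion[OF q] by (auto simp: q_expansions_def)

text \<open>The hypothesis \<open>gap\<close> is equivalent to
  \<open>q - 1 \<le> q / (q - 1)\<close>. It says that the intervals on which the digits 0, 1, q
  keep a point inside the interval from 0 to \<open>q / (q - 1)\<close> leave no gap between the
  digits 1 and q.\<close>

lemma q_expansions_nonempty:
  assumes gap: "(q - 1) * (q - 2) \<le> 1" and "0 \<le> x" "x \<le> q / (q - 1)"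
  shows "q_expansions q x \<noteq> {}"
proof -
  define b where "b = q / (q - 1)"
  have b: "1 \<le> b" "q * b - q = b" using q by (simp_all add: b_def field_simps)
  have "(q - 1) * (q - 1) \<le> q" using gap by (simp add: algebra_simps)
  then have "q - 1 \<le> b" using q by (simp add: b_def pos_le_divide_eq)
  have "\<exists>c\<in>{0, 1, q}. q * y - c \<in> {0..b}" if y: "y \<in> {0..b}" for y
  proof -
    have y0: "0 \<le> q * y" and yb: "q * y \<le> q * b" using y q by auto
    \<comment> \<open>The thresholds \<open>1 / q\<close> and \<open>1\<close> are the left ends of
      the intervals of the digits 1 and q; the digit q fixes the right end \<open>b\<close>.\<close>
    consider "q * y \<le> 1" | "1 \<le> q * y" "y \<le> 1" | "1 \<le> y" by linarith
    then show ?thesis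
    proof cases
      case 1
      then have "q * y - 0 \<in> {0..b}" using y0 b(1) by auto
      then show ?thesis by blast
    next
      case 2
      have "q * y \<le> q * 1" using 2 q by (intro mult_left_mono) auto
      then have "q * y - 1 \<in> {0..b}" using 2 \<open>q - 1 \<le> b\<close> by auto
      then show ?thesis by blast
    next
      case 3
      have "q * 1 \<le> q * y" using 3 q by (intro mult_left_mono) auto
      then have "q * y - q \<in> {0..b}" using yb b(2) by auto
      then show ?thesis by blast
    qed
  qed
  then have "\<exists>d. (\<forall>i. d i \<in> {0, 1, q}) \<and> (\<lambda>i. d i / q ^ Suc i) sums x"
    using assms by (intro expansion_exists[OF q bounded_closed_interval[of 0 b]]) (auto simp: b_def)
  then show ?thesis by (auto simp: q_expansions_def)
qed

section \<open>Constraints on unique expansions\<close>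

lemma expansion_value_const:
  "expansion_value q (\<lambda>_. c) = c / (q - 1)"
  unfolding expansion_value_def using sums_const_expansion[OF q] by (rule sums_unique[symmetric])

lemma unique_digits_value_Suc:
  assumes "unique_digits q d"
  shows "expansion_value q (\<lambda>i. d (Suc i)) = q * expansion_value q d - d 0"
  using q_expansions_value[OF q_expansions_Suc[OF unique_digits_mem[OF assms]]] .

lemma unique_digits_Suc:
  assumes "unique_digits q d" shows "unique_digits q (\<lambda>i. d (Suc i))"
proof -
  let ?y = "q * expansion_value q d - d 0"
  note d = unique_digits_mem[OF assms]
  have "e = (\<lambda>i. d (Suc i))" if "e \<in> q_expansions q ?y" for e
  proof -
    have "case_nat (d 0) e = d"
      using that q_expansions_digit[OF d, of 0] by (intro unique_digits_eqI[OF assms] q_expansions_Cons)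
    then show ?thesis by (metis nat.simps(5) ext)
  qed
  with q_expansions_Suc[OF d] show ?thesis
    unfolding unique_digits_def unique_digits_value_Suc[OF assms] by blast
qed

lemma unique_digits_shift:
  assumes "unique_digits q d" shows "unique_digits q (\<lambda>i. d (i + n))"
proof (induction n)
  case (Suc n)
  then show ?case using unique_digits_Suc by fastforce
qed (use assms in simp)

text \<open>A digit whose remainder has some expansion starts an expansion of the point, which can
  only be \<open>d\<close>. Digits are thus read off from the nonemptiness of remainders.\<close>

lemma unique_digits_0:
  assumes "unique_digits q d" "c \<in> {0, 1, q}"
    and "q_expansions q (q * expansion_value q d - c) \<noteq> {}"
  shows "d 0 = c"
proof -
  obtain e where "e \<in> q_expansions q (q * expansion_value q d - c)" using assms(3) by blast
  then have "case_nat c e = d"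
    by (intro unique_digits_eqI[OF assms(1)] q_expansions_Cons[OF assms(2)])
  then show ?thesis by auto
qed

text \<open>Replacing \<open>10\<close> by \<open>0q\<close> gives a second expansion, because
  \<open>q * 1 + 0 = q * 0 + q\<close>.\<close>

lemma unique_digits_no_10:
  assumes "unique_digits q d" "d n = 1" shows "d (Suc n) \<noteq> 0"
proof
  assume *: "d (Suc n) = 0"
  define e where "e = (\<lambda>i. d (i + n))"
  have e: "unique_digits q e" "e 0 = 1" "e (Suc 0) = 0"
    using unique_digits_shift[OF assms(1), of n] assms * by (auto simp: e_def)
  \<comment> \<open>\<open>z\<close> is the remainder after the word \<open>10\<close>, and equally
    after \<open>0q\<close>.\<close>
  define z where "z = q * (q * expansion_value q e - 1)"
  have "(\<lambda>i. e (Suc (Suc i))) \<in> q_expansions q z"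
    using q_expansions_Suc[OF q_expansions_Suc[OF unique_digits_mem[OF e(1)]]] e by (simp add: z_def)
  moreover have "z = q * (q * expansion_value q e - 0) - q" by (simp add: z_def algebra_simps)
  ultimately have "q_expansions q (q * expansion_value q e - 0) \<noteq> {}"
    using q_expansions_Cons[of q] by (metis empty_iff insert_iff)
  then have "e 0 = 0" by (intro unique_digits_0[OF e(1)]) auto
  then show False using e by simp
qed

lemma unique_digits_no_0q:
  assumes "unique_digits q d" "d n = 0" shows "d (Suc n) \<noteq> q"
proof
  assume *: "d (Suc n) = q"
  define e where "e = (\<lambda>i. d (i + n))"
  have e: "unique_digits q e" "e 0 = 0" "e (Suc 0) = q"
    using unique_digits_shift[OF assms(1), of n] assms * by (auto simp: e_def)
  define z where "z = q * (q * expansion_value q e) - q"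
  have "(\<lambda>i. e (Suc (Suc i))) \<in> q_expansions q z"
    using q_expansions_Suc[OF q_expansions_Suc[OF unique_digits_mem[OF e(1)]]] e by (simp add: z_def)
  moreover have "z = q * (q * expansion_value q e - 1) - 0" by (simp add: z_def algebra_simps)
  ultimately have "q_expansions q (q * expansion_value q e - 1) \<noteq> {}"
    using q_expansions_Cons[of 0] by (metis empty_iff insert_iff)
  then have "e 0 = 1" by (intro unique_digits_0[OF e(1)]) auto
  then show False using e by simp
qed

text \<open>The digit 0 followed by \<open>q\<close> forever has the same value
  \<open>1 / (q - 1)\<close>.\<close>

lemma unique_digits_not_all_1:
  assumes "unique_digits q d" shows "\<not> (\<forall>i. d i = 1)"
proof
  assume *: "\<forall>i. d i = 1"
  then have "expansion_value q d = 1 / (q - 1)"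
    using expansion_value_const[of 1] by (simp flip: fun_eq_iff)
  then have "q * expansion_value q d - 0 = q / (q - 1)" by simp
  then have "d 0 = 0"
    using q_expansions_const[of q] by (intro unique_digits_0[OF assms]) auto
  then show False using * by simp
qed

section \<open>Covers by countably many similar copies\<close>

lemma mem_prefixed:
  assumes "d \<in> q_expansions q x" "expansion_value q (\<lambda>i. d (i + n)) \<in> B"
  shows "x \<in> prefixed q n B"
  using assms
proof (induction n arbitrary: d x)
  case 0
  then show ?case using q_expansions_value by auto
next
  case (Suc n)
  have "q * x - d 0 \<in> prefixed q n B"
    using Suc.prems by (intro Suc.IH[OF q_expansions_Suc]) auto
  moreover have "x = (d 0 + (q * x - d 0)) / q" using q by simp
  moreover have "d 0 \<in> {0, 1, q}" using Suc.prems(1) by (rule q_expansions_digit)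
  ultimately show ?case unfolding prefixed.simps by blast
qed

text \<open>If a 1 occurs, the tail from there lies in \<open>A\<close>. Otherwise a 0 can be
  followed only by zeros, since \<open>0q\<close> is excluded, which gives the tail value 0; and
  without zeros all digits are \<open>q\<close>.\<close>

lemma U_set_subset_prefixed:
  "U_set q \<subseteq> (\<Union>n. prefixed q n (univoque_first_one q \<union> {0, q / (q - 1)}))"
proof
  let ?B = "univoque_first_one q \<union> {0, q / (q - 1)}"
  fix x assume "x \<in> U_set q"
  then obtain d where d: "unique_digits q d" "x = expansion_value q d"
    unfolding U_set_eq_image by blast
  note mem = unique_digits_mem[OF d(1)]
  have digit: "d i \<in> {0, 1, q}" for i using mem by (rule q_expansions_digit)
  have "\<exists>n. expansion_value q (\<lambda>i. d (i + n)) \<in> ?B"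
  proof (cases "\<exists>n. d n = 1")
    case True
    then obtain n where "d n = 1" by blast
    then have "expansion_value q (\<lambda>i. d (i + n)) \<in> univoque_first_one q"
      using unique_digits_shift[OF d(1), of n] unfolding univoque_first_one_def by auto
    then show ?thesis by blast
  next
    case no_1: False
    show ?thesis
    proof (cases "\<exists>n. d n = 0")
      case True
      then obtain n where n: "d n = 0" by blast
      have "d (i + n) = 0" for i
      proof (induction i)
        case (Suc i)
        then show ?case using unique_digits_no_0q[OF d(1), of "i + n"] digit[of "Suc i + n"] no_1 by auto
      qed (use n in simp)
      then have "expansion_value q (\<lambda>i. d (i + n)) = 0" using expansion_value_const[of 0] by simp
      then show ?thesis by (intro exI[of _ n]) auto
    next
      case False
      then have "d i = q" for i using digit[of i] no_1 by blast
      then have "expansion_value q (\<lambda>i. d (i + 0)) = q / (q - 1)"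
        using expansion_value_const[of q] by simp
      then show ?thesis by (intro exI[of _ 0]) auto
    qed
  qed
  then obtain n where "expansion_value q (\<lambda>i. d (i + n)) \<in> ?B" ..
  then have "x \<in> prefixed q n ?B" unfolding d(2) by (rule mem_prefixed[OF mem])
  then show "x \<in> (\<Union>n. prefixed q n ?B)" by (rule UN_I[OF UNIV_I])
qed

text \<open>If the first \<open>n\<close> digits already single out \<open>d\<close> among all
  expansions, then the tail of \<open>d\<close> after them is a unique expansion.\<close>

lemma separated_expansion_mem_prefixed:
  assumes "d \<in> q_expansions q x"
    and "\<And>e. e \<in> q_expansions q x \<Longrightarrow> (\<forall>i<n. e i = d i) \<Longrightarrow> e = d"
  shows "x \<in> prefixed q n (U_set q)"
  using assms
proof (induction n arbitrary: d x)
  case 0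
  then have "q_expansions q x = {d}" by blast
  then show ?case unfolding U_set_eq by simp
next
  case (Suc n)
  have d0: "d 0 \<in> {0, 1, q}" using Suc.prems(1) by (rule q_expansions_digit)
  have "q * x - d 0 \<in> prefixed q n (U_set q)"
  proof (rule Suc.IH[OF q_expansions_Suc[OF Suc.prems(1)]])
    fix e assume e: "e \<in> q_expansions q (q * x - d 0)" "\<forall>i<n. e i = d (Suc i)"
    have "case_nat (d 0) e = d"
      using e by (intro Suc.prems(2) q_expansions_Cons[OF d0]) (auto split: nat.split)
    then show "e = (\<lambda>i. d (Suc i))" by (metis nat.simps(5) ext)
  qed
  moreover have "x = (d 0 + (q * x - d 0)) / q" using q by simp
  ultimately show ?case using d0 unfolding prefixed.simps by blast
qed

lemma U_k_subset_prefixed: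
  assumes "k \<ge> 1" shows "U_k k q \<subseteq> (\<Union>n. prefixed q n (U_set q))"
proof
  fix x assume "x \<in> U_k k q"
  then have card: "card (q_expansions q x) = k" by (simp add: U_k_def)
  then have fin: "finite (q_expansions q x)" using assms by (intro card_ge_0_finite) auto
  obtain d where d: "d \<in> q_expansions q x" using card assms by fastforce
  have "\<forall>e. \<exists>m. e \<noteq> d \<longrightarrow> e m \<noteq> d m" by auto
  then obtain m where m: "\<And>e. e \<noteq> d \<Longrightarrow> e (m e) \<noteq> d (m e)" by metis
  \<comment> \<open>Beyond every chosen position \<open>m e\<close> at which one of the finitely
    many other expansions differs from \<open>d\<close>; \<open>Suc\<close> makes the comparison of
    indices below \<open>n\<close> include the largest one.\<close>
  define n where "n = Suc (Max (m ` q_expansions q x))"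
  have "m e < n" if "e \<in> q_expansions q x" for e
    unfolding n_def using fin that by (simp add: less_Suc_eq_le)
  then have "x \<in> prefixed q n (U_set q)"
    using m by (intro separated_expansion_mem_prefixed[OF d]) blast
  then show "x \<in> (\<Union>n. prefixed q n (U_set q))" by blast
qed

section \<open>Location of the points whose unique expansion starts with 1\<close>

text \<open>If the digit intervals leave no gap, a point \<open>x \<ge> 1\<close> could also start
  with \<open>q\<close>. If there is a gap, then even the largest possible tail after a 1 is below
  \<open>q - 1\<close>.\<close>

lemma univoque_first_one_less_1:
  assumes "x \<in> univoque_first_one q" "q > 2" shows "x < 1"
proof (cases "(q - 1) * (q - 2) \<le> 1")
  case True
  obtain d where d: "unique_digits q d" "d 0 = 1" "x = expansion_value q d"
    using assms(1) by (auto simp: univoque_first_one_def)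
  show ?thesis
  proof (rule ccontr)
    assume "\<not> x < 1"
    then have "q * 1 \<le> q * x" using q by (intro mult_left_mono) auto
    moreover have "x \<le> q / (q - 1)"
      using q_expansions_bounds(2)[of x] unique_digits_mem[OF d(1)] d(3) by blast
    then have "q * x \<le> q * (q / (q - 1))" using q by (intro mult_left_mono) auto
    moreover have "q * (q / (q - 1)) - q = q / (q - 1)" using q by (simp add: field_simps)
    ultimately have "q_expansions q (q * x - q) \<noteq> {}"
      by (intro q_expansions_nonempty[OF True]) auto
    then have "d 0 = q" using unique_digits_0[OF d(1), of q] d(3) by auto
    then show False using d(2) q by simp
  qed
next
  case False
  obtain d where d: "unique_digits q d" "d 0 = 1" "x = expansion_value q d"
    using assms(1) by (auto simp: univoque_first_one_def)
  have "q_expansions q (q * x - 1) \<noteq> {}"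
    using q_expansions_Suc[OF unique_digits_mem[OF d(1)]] d by auto
  then have "q * x - 1 \<le> q / (q - 1)" by (rule q_expansions_bounds)
  also have "q / (q - 1) < q - 1" using False q by (simp add: field_simps)
  finally have "q * x < q * 1" by simp
  then show ?thesis using q by simp
qed

text \<open>The first digit other than 1 is \<open>q\<close>, as \<open>10\<close> is excluded, and
  the tail there is at least 1. Prepending a 1 preserves being above \<open>1 / (q - 1)\<close>, the
  fixed point of \<open>y \<mapsto> (1 + y) / q\<close>.\<close>

lemma univoque_first_one_greater:
  assumes "x \<in> univoque_first_one q" "q > 2" shows "x > 1 / (q - 1)"
proof -
  obtain d where d: "unique_digits q d" "d 0 = 1" "x = expansion_value q d"
    using assms(1) by (auto simp: univoque_first_one_def)
  note digit = q_expansions_digit[OF unique_digits_mem[OF d(1)]]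
  obtain m where "d m \<noteq> 1" using unique_digits_not_all_1[OF d(1)] by blast
  define j where "j = (LEAST m. d m \<noteq> 1)"
  have j: "d j \<noteq> 1" unfolding j_def using \<open>d m \<noteq> 1\<close> by (rule LeastI)
  have before: "d i = 1" if "i < j" for i using not_less_Least that unfolding j_def by blast
  have "j \<noteq> 0" using j d(2) by metis
  then have "d (j - 1) = 1" by (intro before) simp
  then have "d j \<noteq> 0" using unique_digits_no_10[OF d(1), of "j - 1"] \<open>j \<noteq> 0\<close> by simp
  then have "d j = q" using digit[of j] j by blast
  \<comment> \<open>Backward induction from the position \<open>j\<close> of that \<open>q\<close>;
    \<open>l\<close> is the number of ones put back in front.\<close>
  have "expansion_value q (\<lambda>i. d (i + (j - l))) > 1 / (q - 1)" if "l \<le> j" for l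
    using that
  proof (induction l)
    case 0
    let ?e = "\<lambda>i. d (i + j)"
    have e: "unique_digits q ?e" using d(1) by (rule unique_digits_shift)
    have "0 \<le> expansion_value q (\<lambda>i. ?e (Suc i))"
      using q_expansions_bounds(1) unique_digits_mem[OF unique_digits_Suc[OF e]] by blast
    then have "q * 1 \<le> q * expansion_value q ?e"
      using unique_digits_value_Suc[OF e] \<open>d j = q\<close> by simp
    then have "1 \<le> expansion_value q ?e" using q by simp
    moreover have "1 / (q - 1) < 1" using assms(2) by simp
    ultimately show ?case by simp
  next
    case (Suc l)
    let ?e = "\<lambda>i. d (i + (j - Suc l))"
    have e: "unique_digits q ?e" using d(1) by (rule unique_digits_shift)
    have "Suc (i + (j - Suc l)) = i + (j - l)" for i using Suc.prems by simp
    then have "1 / (q - 1) < expansion_value q (\<lambda>i. ?e (Suc i))"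
      using Suc by simp
    also have "\<dots> = q * expansion_value q ?e - 1"
      using unique_digits_value_Suc[OF e] before[of "j - Suc l"] Suc.prems by simp
    finally have "q * (1 / (q - 1)) < q * expansion_value q ?e"
      using q by (simp add: field_simps)
    then show ?case using q by (simp only: mult_less_cancel_left_pos)
  qed
  from this[of j] show ?thesis using d(3) by simp
qed

text \<open>For these \<open>q\<close> a unique expansion with a digit \<open>1\<close> would have to continue with \<open>1\<close>s only,
  since the tail after \<open>1q\<close> falls into the overlap of the intervals of the digits \<open>0\<close> and \<open>1\<close>;
  but \<open>1\<^sup>\<infinity> = 0q\<^sup>\<infinity>\<close>.\<close>

lemma univoque_first_one_empty:
  assumes crit: "q * (q - 1) * (q - 2) \<le> 1" shows "univoque_first_one q = {}"
proof -
  have gap: "(q - 1) * (q - 2) \<le> 1"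
  proof (cases "q \<le> 2")
    case True
    then have "(q - 1) * (q - 2) \<le> 0" using q by (intro mult_nonneg_nonpos) auto
    then show ?thesis by simp
  next
    case False
    then have "1 * ((q - 1) * (q - 2)) \<le> q * ((q - 1) * (q - 2))"
      using q by (intro mult_right_mono) auto
    then show ?thesis using crit by (simp add: mult.assoc)
  qed
  \<comment> \<open>Two rearrangements of the critical inequality: they will confine the tail after
    \<open>1q\<close> to the interval from \<open>1 / q\<close> to
    \<open>1 / (q - 1)\<close>.\<close>
  have bounds: "q * q - 2 * q \<le> 1 / (q - 1)" "1 / q \<le> 1 + q / (q - 1) - q"
    using crit q by (simp_all add: field_simps)
  note nonempty = q_expansions_nonempty[OF gap]
  have step: "e 1 = 1" if e: "unique_digits q e" "e 0 = 1" for e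
  proof (rule ccontr)
    assume "e 1 \<noteq> 1"
    note mem = unique_digits_mem[OF e(1)]
    have "e 1 = q"
      using q_expansions_digit[OF mem, of 1] \<open>e 1 \<noteq> 1\<close> unique_digits_no_10[OF e] by auto
    \<comment> \<open>Values of \<open>e\<close> and of its tails after \<open>1\<close> and after
      \<open>1q\<close>.\<close>
    define x x' x'' where "x = expansion_value q e"
      and "x' = expansion_value q (\<lambda>i. e (Suc i))"
      and "x'' = expansion_value q (\<lambda>i. e (Suc (Suc i)))"
    note e' = unique_digits_Suc[OF e(1)]
    note e'' = unique_digits_Suc[OF e']
    have x': "x' = q * x - 1"
      using unique_digits_value_Suc[OF e(1)] e(2) by (simp add: x_def x'_def)
    have x'': "x'' = q * x' - q"
      using unique_digits_value_Suc[OF e'] \<open>e 1 = q\<close> by (simp add: x'_def x''_def)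
    have nn: "0 \<le> x''" and "x' \<le> q / (q - 1)" "x \<le> q / (q - 1)"
      using q_expansions_bounds unique_digits_mem[OF e''] unique_digits_mem[OF e'] mem
      unfolding x_def x'_def x''_def by blast+
    have "x < 1"
    proof (rule ccontr)
      assume "\<not> x < 1"
      then have "q * 1 \<le> q * x" using q by (intro mult_left_mono) auto
      moreover have "q * x \<le> q * (q / (q - 1))"
        using q \<open>x \<le> q / (q - 1)\<close> by (intro mult_left_mono) auto
      moreover have "q * (q / (q - 1)) - q = q / (q - 1)" using q by (simp add: field_simps)
      ultimately have "q_expansions q (q * x - q) \<noteq> {}" by (intro nonempty) auto
      then have "e 0 = q" using unique_digits_0[OF e(1), of q] by (auto simp: x_def)
      then show False using e(2) q by simp
    qed
    then have "q * x < q * 1" using q by (intro mult_strict_left_mono) auto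
    then have "x' < q - 1" by (simp add: x')
    then have "q * x' < q * (q - 1)" using q by (intro mult_strict_left_mono) auto
    then have up: "x'' \<le> 1 / (q - 1)" using bounds(1) by (simp add: x'' algebra_simps)
    have "q * 1 \<le> q * x'" using nn by (simp add: x'')
    then have "1 < q * x'" using q by linarith
    \<comment> \<open>Otherwise the digit 1 would be possible in place of the \<open>q\<close> at
      position 1.\<close>
    have "q * x' - 1 > q / (q - 1)"
    proof (rule ccontr)
      assume "\<not> q * x' - 1 > q / (q - 1)"
      then have "q_expansions q (q * x' - 1) \<noteq> {}" using \<open>1 < q * x'\<close> by (intro nonempty) auto
      then have "e 1 = 1" using unique_digits_0[OF e', of 1] by (auto simp: x'_def)
      then show False using \<open>e 1 \<noteq> 1\<close> by simp
    qed
    then have "1 / q \<le> x''" using bounds(2) by (simp add: x'')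
    then have "1 \<le> q * x''" using q by (simp add: field_simps)
    moreover have "q * x'' \<le> q * (1 / (q - 1))" using up q by (intro mult_left_mono) auto
    moreover have "q * (1 / (q - 1)) = q / (q - 1)" by simp
    \<comment> \<open>Between \<open>1 / q\<close> and \<open>1 / (q - 1)\<close> both 0 and 1 can
      come next, which contradicts uniqueness of the tail.\<close>
    ultimately have "q_expansions q (q * x'' - 0) \<noteq> {}" "q_expansions q (q * x'' - 1) \<noteq> {}"
      by (intro nonempty; linarith)+
    then have "e 2 = 0" "e 2 = 1"
      using unique_digits_0[OF e'', of 0] unique_digits_0[OF e'', of 1]
      by (auto simp: x''_def numeral_2_eq_2)
    then show False by simp
  qed
  have False if d: "unique_digits q d" "d 0 = 1" for d
  proof -
    have "d n = 1" for n
    proof (induction n)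
      case (Suc n)
      then show ?case using step[OF unique_digits_shift[OF d(1), of n]] by simp
    qed (use d in simp)
    then show False using unique_digits_not_all_1[OF d(1)] by blast
  qed
  then show ?thesis by (auto simp: univoque_first_one_def)
qed

section \<open>Forced first digits\<close>

text \<open>Here and in the next two lemmas the other digits leave remainders outside the interval
  from 0 to \<open>q / (q - 1)\<close>; in this case they are negative.\<close>

lemma q_expansions_forced_0:
  assumes "y < 1" shows "q_expansions q (y / q) = case_nat 0 ` q_expansions q y"
proof -
  have "q_expansions q (q * (y / q) - c) = {}" if "c \<ge> 1" for c
    using q_expansions_bounds(1)[of "q * (y / q) - c"] assms that q by auto
  from this[of 1] this[of q] show ?thesis
    using q by (subst q_expansions_unfold) simp
qed

text \<open>The lower bound on \<open>y\<close> rules out the digit 0, since \<open>1 + y\<close>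
  exceeds \<open>q / (q - 1)\<close>; the upper bound rules out \<open>q\<close>.\<close>

lemma q_expansions_forced_1:
  assumes "1 / (q - 1) < y" "y < q - 1"
  shows "q_expansions q ((1 + y) / q) = case_nat 1 ` q_expansions q y"
proof -
  have eq: "q * ((1 + y) / q) = 1 + y" using q by simp
  have "q / (q - 1) = 1 + 1 / (q - 1)" using q by (simp add: field_simps)
  then have "q_expansions q (1 + y) = {}" "q_expansions q (1 + y - q) = {}"
    using q_expansions_bounds(2)[of "1 + y"] q_expansions_bounds(1)[of "1 + y - q"] assms by fastforce+
  then show ?thesis using q by (subst q_expansions_unfold) (simp add: eq)
qed

lemma q_expansions_forced_q:
  assumes "1 / (q - 1) < y" "q > 2"
  shows "q_expansions q (1 + y / q) = case_nat q ` q_expansions q y"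
proof -
  have eq: "q * (1 + y / q) = q + y" using q by (simp add: algebra_simps)
  have "q / (q - 1) = 1 + 1 / (q - 1)" using q by (simp add: field_simps)
  then have "q_expansions q (q + y) = {}" "q_expansions q (q + y - 1) = {}"
    using q_expansions_bounds(2)[of "q + y"] q_expansions_bounds(2)[of "q + y - 1"] assms by fastforce+
  then show ?thesis using q by (subst q_expansions_unfold) (simp add: eq)
qed

end

section \<open>Positive dimension above the critical base\<close>

text \<open>If the first digit of every tail is forced, any competing expansion agrees with
  \<open>d\<close> digit by digit.\<close>

lemma unique_digits_if_forced:
  assumes "q > 1" and digit: "\<And>i. d i \<in> {0, 1, q}"
    and forced: "\<And>n. q_expansions q (expansion_value q (\<lambda>i. d (i + n))) =
      case_nat (d n) ` q_expansions q (expansion_value q (\<lambda>i. d (i + Suc n)))"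
  shows "unique_digits q d"
proof -
  have "\<bar>d i\<bar> \<le> q" for i using digit[of i] \<open>q > 1\<close> by auto
  then have "(\<lambda>i. d i / q ^ Suc i) sums expansion_value q d"
    by (rule sums_expansion_value[OF \<open>q > 1\<close>])
  then have mem: "d \<in> q_expansions q (expansion_value q d)"
    using digit unfolding q_expansions_def by blast
  have agree: "e i = d (i + n)" if "e \<in> q_expansions q (expansion_value q (\<lambda>i. d (i + n)))" for e i n
    using that
  proof (induction i arbitrary: e n)
    case 0
    then show ?case unfolding forced[of n] by auto
  next
    case (Suc i)
    then obtain e' where e': "e = case_nat (d n) e'"
        "e' \<in> q_expansions q (expansion_value q (\<lambda>i. d (i + Suc n)))"
      unfolding forced[of n] by blast
    then show ?case using Suc.IH[OF e'(2)] by simp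
  qed
  have "e = d" if "e \<in> q_expansions q (expansion_value q d)" for e
    using agree[of e 0] that by auto
  then show ?thesis using mem unfolding unique_digits_def by blast
qed

text \<open>Each \<open>q\<close> is followed by at least \<open>p\<close> ones. Recurring
  \<open>q\<close>s exclude tails of ones only, which are not unique, and allow induction on the
  distance to some \<open>q\<close>.\<close>

definition sparse :: "real \<Rightarrow> nat \<Rightarrow> (nat \<Rightarrow> real) \<Rightarrow> bool" where
  "sparse q p d \<longleftrightarrow> (\<forall>i. d i \<in> {1, q}) \<and> (\<forall>i. d i = q \<longrightarrow> (\<forall>j<p. d (i + Suc j) = 1)) \<and>
    (\<forall>n. \<exists>i\<ge>n. d i = q)"

lemma sparse_shift:
  assumes "sparse q p d" shows "sparse q p (\<lambda>i. d (i + n))"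
proof -
  have "\<exists>i\<ge>m. d (i + n) = q" for m
  proof -
    obtain i where "i \<ge> m + n" "d i = q" using assms unfolding sparse_def by blast
    then show ?thesis by (intro exI[of _ "i - n"]) auto
  qed
  moreover have "d (i + n + Suc j) = 1" if "d (i + n) = q" "j < p" for i j
    using assms that unfolding sparse_def by blast
  then have "d (i + Suc j + n) = 1" if "d (i + n) = q" "j < p" for i j
    using that by (metis add.assoc add.commute)
  ultimately show ?thesis using assms unfolding sparse_def by blast
qed

section \<open>Sparse sequences are unique expansions\<close>

context
  fixes q :: real and p :: nat
  assumes q: "q > 2" and p: "1 / (q - 1) + 1 / q ^ p < q * (q - 2)"
begin

lemma sparse_abs_le:
  assumes "sparse q p d" shows "\<bar>d i\<bar> \<le> q"
proof -
  have "d i \<in> {1, q}" using assms by (simp add: sparse_def)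
  then show ?thesis using q by auto
qed

lemma sparse_value_bounds:
  assumes "sparse q p d" shows "1 / (q - 1) \<le> expansion_value q d" "expansion_value q d \<le> q / (q - 1)"
proof -
  have "1 \<le> d i" "d i \<le> q" for i
  proof -
    have "d i \<in> {1, q}" using assms by (simp add: sparse_def)
    then show "1 \<le> d i" "d i \<le> q" using q by auto
  qed
  moreover have "(\<lambda>i. d i / q ^ Suc i) sums expansion_value q d"
    using sparse_abs_le[OF assms] q by (intro sums_expansion_value) auto
  ultimately show "1 / (q - 1) \<le> expansion_value q d" "expansion_value q d \<le> q / (q - 1)"
    using sums_expansion_bounds[of q d _ 1 q] q by auto
qed

lemma sparse_value_Suc:
  assumes "sparse q p d"
  shows "expansion_value q d = (d 0 + expansion_value q (\<lambda>i. d (Suc i))) / q"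
  using q sparse_abs_le[OF assms] by (intro expansion_value_Suc) auto

text \<open>Together with \<open>sparse_value_upper\<close> the second bound leaves a gap of
  \<open>1 / (q * (q - 1))\<close> between sequences starting with \<open>q\<close> and those
  starting with 1.\<close>

lemma sparse_value_q:
  assumes "sparse q p d" "d 0 = q"
  shows "expansion_value q d = 1 + expansion_value q (\<lambda>i. d (Suc i)) / q"
    "1 + 1 / (q * (q - 1)) \<le> expansion_value q d"
proof -
  show eq: "expansion_value q d = 1 + expansion_value q (\<lambda>i. d (Suc i)) / q"
    using sparse_value_Suc[OF assms(1)] assms(2) q by (simp add: add_divide_distrib)
  have "1 / (q - 1) \<le> expansion_value q (\<lambda>i. d (Suc i))"
    using sparse_value_bounds(1)[OF sparse_shift[OF assms(1), of 1]] by simp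
  then have "1 / (q - 1) / q \<le> expansion_value q (\<lambda>i. d (Suc i)) / q"
    using q by (intro divide_right_mono) auto
  then show "1 + 1 / (q * (q - 1)) \<le> expansion_value q d"
    unfolding eq by (simp add: mult.commute)
qed

text \<open>After a \<open>q\<close> come \<open>p\<close> ones, so the tail exceeds
  \<open>1 / (q - 1)\<close> by at most \<open>1 / q ^ p\<close>; the condition on \<open>p\<close>
  puts it below \<open>q * (q - 2)\<close>, and the value with the \<open>q\<close> in front below
  \<open>q - 1\<close>. Prepending a 1 to a value below \<open>q - 1\<close> gives a value below
  1.\<close>

lemma sparse_value_upper:
  assumes d: "sparse q p d"
  shows "expansion_value q d < q - 1" "d 0 = 1 \<Longrightarrow> expansion_value q d < 1"
proof -
  have first_q: "expansion_value q e < q - 1" if e: "sparse q p e" "e 0 = q" for e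
  proof -
    let ?e = "\<lambda>i. e (Suc i)"
    have e': "sparse q p ?e" using sparse_shift[OF e(1), of 1] by simp
    have ones: "?e i = 1" if "i < p" for i
      using e that unfolding sparse_def by (metis add_0)
    have "1 / (q - 1) = (\<Sum>i<p. 1 / q ^ Suc i) + 1 / (q - 1) / q ^ p"
      using expansion_value_split[of q "\<lambda>_. 1" 1 p] expansion_value_const[of q] q
      by (simp only: abs_one order_refl)
    moreover have "expansion_value q ?e =
        (\<Sum>i<p. ?e i / q ^ Suc i) + expansion_value q (\<lambda>i. ?e (i + p)) / q ^ p"
      using q sparse_abs_le[OF e'] by (intro expansion_value_split) auto
    moreover have "(\<Sum>i<p. ?e i / q ^ Suc i) = (\<Sum>i<p. 1 / q ^ Suc i)"
      using ones by (intro sum.cong) auto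
    moreover have "expansion_value q (\<lambda>i. ?e (i + p)) / q ^ p \<le> q / (q - 1) / q ^ p"
      using sparse_value_bounds(2)[OF sparse_shift[OF e', of p]] q by (intro divide_right_mono) auto
    moreover have "q / (q - 1) / q ^ p = 1 / (q - 1) / q ^ p + 1 / q ^ p"
    proof -
      have "q / (q - 1) = 1 / (q - 1) + 1" using q by (simp add: field_simps)
      then show ?thesis by (simp add: add_divide_distrib)
    qed
    ultimately have "expansion_value q ?e < q * (q - 2)" using p by linarith
    then have "expansion_value q ?e / q < q - 2" using q by (simp add: divide_less_eq mult.commute)
    then show ?thesis using sparse_value_q(1)[OF e] by simp
  qed
  have first_1: "expansion_value q e < 1"
    if "sparse q p e" "e 0 = 1" "expansion_value q (\<lambda>i. e (Suc i)) < q - 1" for e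
    using sparse_value_Suc[OF that(1)] that q by simp
  have upper: "expansion_value q e < q - 1" if "sparse q p e" "e m = q" for e m
    using that
  proof (induction m arbitrary: e)
    case (Suc m)
    have "expansion_value q (\<lambda>i. e (Suc i)) < q - 1"
      using Suc.IH[of "\<lambda>i. e (Suc i)"] Suc.prems sparse_shift[of q p e 1] by simp
    moreover have "e 0 = 1 \<or> e 0 = q" using Suc.prems(1) by (simp add: sparse_def)
    ultimately show ?case using first_1[OF Suc.prems(1)] first_q[OF Suc.prems(1)] q by auto
  qed (use first_q in simp)
  show less: "expansion_value q d < q - 1"
    using upper d unfolding sparse_def by blast
  have "expansion_value q (\<lambda>i. d (Suc i)) < q - 1"
    using upper[of "\<lambda>i. d (i + 1)"] sparse_shift[OF d, of 1] unfolding sparse_def by auto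
  then show "d 0 = 1 \<Longrightarrow> expansion_value q d < 1" using first_1[OF d] by simp
qed

text \<open>The bound is strict at a \<open>q\<close>, and prepending further digits keeps it strict
  because \<open>1 / (q - 1)\<close> is fixed by prepending a 1.\<close>

lemma sparse_value_greater:
  assumes d: "sparse q p d" shows "1 / (q - 1) < expansion_value q d"
proof -
  have "1 / (q - 1) < expansion_value q e" if "sparse q p e" "e m = q" for e m
    using that
  proof (induction m arbitrary: e)
    case 0
    have "1 / (q - 1) < 1" "1 / (q * (q - 1)) > 0" using q by simp_all
    then show ?case using sparse_value_q(2)[of e] 0 by linarith
  next
    case (Suc m)
    have "1 / (q - 1) < expansion_value q (\<lambda>i. e (Suc i))"
      using Suc.IH[of "\<lambda>i. e (Suc i)"] Suc.prems sparse_shift[of q p e 1] by simp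
    moreover have "1 \<le> e 0"
    proof -
      have "e 0 = 1 \<or> e 0 = q" using Suc.prems(1) by (simp add: sparse_def)
      then show ?thesis using q by auto
    qed
    ultimately have "1 + 1 / (q - 1) < q * expansion_value q e"
      using sparse_value_Suc[OF Suc.prems(1)] q by simp
    moreover have "1 + 1 / (q - 1) = q * (1 / (q - 1))" using q by (simp add: field_simps)
    ultimately have "q * (1 / (q - 1)) < q * expansion_value q e" by simp
    then show ?case using q by (simp only: mult_less_cancel_left_pos)
  qed
  then show ?thesis using d unfolding sparse_def by blast
qed

text \<open>All tails lie strictly between \<open>1 / (q - 1)\<close> and \<open>q - 1\<close>,
  where a prepended 1 or \<open>q\<close> is forced.\<close>

lemma sparse_unique:
  assumes d: "sparse q p d" shows "unique_digits q d"
proof (rule unique_digits_if_forced)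
  show "q > 1" using q by simp
  have digit: "d i = 1 \<or> d i = q" for i using d by (simp add: sparse_def)
  then show "d i \<in> {0, 1, q}" for i by blast
  fix n
  let ?e = "\<lambda>i. d (i + n)" and ?e' = "\<lambda>i. d (i + Suc n)"
  have e: "sparse q p ?e" and e': "sparse q p ?e'" using d by (rule sparse_shift)+
  have eq: "expansion_value q ?e = (d n + expansion_value q ?e') / q"
    using sparse_value_Suc[OF e] by simp
  note bounds = sparse_value_greater[OF e'] sparse_value_upper(1)[OF e']
  show "q_expansions q (expansion_value q ?e) = case_nat (d n) ` q_expansions q (expansion_value q ?e')"
    using digit[of n]
  proof
    assume "d n = 1"
    then show ?thesis using q_expansions_forced_1[OF \<open>q > 1\<close> bounds] eq by simp
  next
    assume "d n = q"
    then show ?thesis using q_expansions_forced_q[OF \<open>q > 1\<close> bounds(1) q] eq q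
      by (simp add: add_divide_distrib)
  qed
qed

end

section \<open>Coding binary sequences by sparse expansions\<close>

text \<open>Only multiples of \<open>Suc p\<close> may carry a \<open>q\<close>, so \<open>p\<close>
  ones lie in between. Even multiples always carry it, which makes it recur; the multiple
  \<open>2 * j + 1\<close> stores the bit \<open>b j\<close>.\<close>

definition coded_digits :: "real \<Rightarrow> nat \<Rightarrow> (nat \<Rightarrow> bool) \<Rightarrow> nat \<Rightarrow> real" where
  "coded_digits q p b i =
    (if Suc p dvd i \<and> (even (i div Suc p) \<or> b (i div Suc p div 2)) then q else 1)"

lemma sparse_coded_digits:
  assumes "q \<noteq> 1" shows "sparse q p (coded_digits q p b)"
  unfolding sparse_def
proof (intro conjI allI impI)
  show "coded_digits q p b i \<in> {1, q}" for i by (simp add: coded_digits_def)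
  fix i j assume "coded_digits q p b i = q" "j < p"
  then have "Suc p dvd i" using assms by (auto simp: coded_digits_def split: if_splits)
  moreover have "\<not> Suc p dvd Suc j" using \<open>j < p\<close> by (auto dest: dvd_imp_le)
  ultimately have "\<not> Suc p dvd i + Suc j" by (metis dvd_add_right_iff)
  then show "coded_digits q p b (i + Suc j) = 1" unfolding coded_digits_def by argo
next
  fix n
  have "coded_digits q p b (Suc p * (2 * n)) = q"
    unfolding coded_digits_def by (simp del: mult_Suc)
  moreover have "n \<le> Suc p * (2 * n)" by simp
  ultimately show "\<exists>i\<ge>n. coded_digits q p b i = q" by blast
qed

definition binary_value :: "(nat \<Rightarrow> bool) \<Rightarrow> real" where
  "binary_value b = expansion_value 2 (\<lambda>i. of_bool (b i))"

lemma range_binary_value: "{0..1} \<subseteq> range binary_value"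
proof
  fix x :: real assume x: "x \<in> {0..1}"
  have "\<exists>c\<in>{0, 1}. 2 * y - c \<in> {0..1}" if "y \<in> {0..1}" for y :: real
    using that by (cases "2 * y \<le> 1") auto
  then obtain d where d: "\<And>i. d i \<in> {0, 1 :: real}" "(\<lambda>i. d i / 2 ^ Suc i) sums x"
    using expansion_exists[of 2 "{0..1}" x "{0, 1}"] x by auto
  have "of_bool (d i = 1) = d i" for i using d(1)[of i] by auto
  then have "binary_value (\<lambda>i. d i = 1) = x"
    using sums_unique[OF d(2)] by (simp add: binary_value_def expansion_value_def)
  then show "x \<in> range binary_value" by blast
qed

lemma binary_value_diff:
  assumes "\<And>i. i < j \<Longrightarrow> b i = b' i" shows "\<bar>binary_value b - binary_value b'\<bar> \<le> 1 / 2 ^ j"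
proof -
  have unit: "0 \<le> expansion_value 2 (\<lambda>i. of_bool (b i))" "expansion_value 2 (\<lambda>i. of_bool (b i)) \<le> 1" for b
  proof -
    have "(\<lambda>i. of_bool (b i) / 2 ^ Suc i) sums expansion_value 2 (\<lambda>i. of_bool (b i))"
      by (rule sums_expansion_value[where M = 1]) auto
    from sums_expansion_bounds[OF _ this, of 0 1]
    show "0 \<le> expansion_value 2 (\<lambda>i. of_bool (b i))" "expansion_value 2 (\<lambda>i. of_bool (b i)) \<le> 1"
      by auto
  qed
  have split: "binary_value b = (\<Sum>i<j. of_bool (b i) / 2 ^ Suc i) +
      expansion_value 2 (\<lambda>i. of_bool (b (i + j))) / 2 ^ j" for b
    unfolding binary_value_def by (rule expansion_value_split[where M = 1]) auto
  have "(\<Sum>i<j. of_bool (b i) / 2 ^ Suc i :: real) = (\<Sum>i<j. of_bool (b' i) / 2 ^ Suc i)"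
    using assms by (intro sum.cong) auto
  then have "binary_value b - binary_value b' =
      (expansion_value 2 (\<lambda>i. of_bool (b (i + j))) - expansion_value 2 (\<lambda>i. of_bool (b' (i + j)))) / 2 ^ j"
    using split[of b] split[of b'] by (simp add: diff_divide_distrib)
  moreover have "\<bar>expansion_value 2 (\<lambda>i. of_bool (b (i + j))) - expansion_value 2 (\<lambda>i. of_bool (b' (i + j)))\<bar> \<le> 1"
    using unit[of "\<lambda>i. b (i + j)"] unit[of "\<lambda>i. b' (i + j)"] by linarith
  ultimately show ?thesis by (simp add: abs_divide divide_right_mono)
qed

text \<open>The first differing bit \<open>j\<close> sits at position
  \<open>Suc p * (2 * j + 1)\<close>. Up to there the digits agree, and the tails start with
  \<open>q\<close> and with 1, so the gap between these two cases is scaled by the common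
  prefix.\<close>

lemma coded_digits_separation:
  assumes q: "q > 2" and p: "1 / (q - 1) + 1 / q ^ p < q * (q - 2)"
    and agree: "\<And>i. i < j \<Longrightarrow> b i = b' i" and differ: "b j" "\<not> b' j"
  shows "1 / (q * (q - 1)) / q ^ (Suc p * (2 * j + 1)) \<le>
    expansion_value q (coded_digits q p b) - expansion_value q (coded_digits q p b')"
proof -
  define N where "N = Suc p * (2 * j + 1)"
  have s: "sparse q p (coded_digits q p b)" for b using q by (intro sparse_coded_digits) simp
  have N: "N div Suc p = 2 * j + 1" "Suc p dvd N"
    unfolding N_def by (metis nonzero_mult_div_cancel_left nat.distinct(1), metis dvd_triv_left)
  have "coded_digits q p b N = q" "coded_digits q p b' N = 1"
    using differ N by (simp_all add: coded_digits_def del: dvd_imp_mod_0)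
  then have tails: "1 + 1 / (q * (q - 1)) \<le> expansion_value q (\<lambda>i. coded_digits q p b (i + N))"
      "expansion_value q (\<lambda>i. coded_digits q p b' (i + N)) < 1"
    using sparse_value_q(2)[OF q p sparse_shift[OF s], of b N]
      sparse_value_upper(2)[OF q p sparse_shift[OF s], of b' N] by simp_all
  have "coded_digits q p b i = coded_digits q p b' i" if "i < N" for i
  proof -
    have "i div Suc p < 2 * j + 1"
      using that unfolding N_def by (metis less_mult_imp_div_less mult.commute)
    \<comment> \<open>Earlier multiples either carry a constant \<open>q\<close> or store a bit of
      index below \<open>j\<close>.\<close>
    moreover have "even m \<or> m div 2 < j" if "m < 2 * j + 1" for m :: nat
      using that by presburger
    ultimately have "even (i div Suc p) \<or> i div Suc p div 2 < j" by blast
    then show ?thesis using agree unfolding coded_digits_def by auto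
  qed
  then have "(\<Sum>i<N. coded_digits q p b i / q ^ Suc i) = (\<Sum>i<N. coded_digits q p b' i / q ^ Suc i)"
    by (intro sum.cong) auto
  moreover have "expansion_value q (coded_digits q p b) = (\<Sum>i<N. coded_digits q p b i / q ^ Suc i) +
      expansion_value q (\<lambda>i. coded_digits q p b (i + N)) / q ^ N" for b
    using q sparse_abs_le[OF q p s] by (intro expansion_value_split) auto
  ultimately have "expansion_value q (coded_digits q p b) - expansion_value q (coded_digits q p b') =
      (expansion_value q (\<lambda>i. coded_digits q p b (i + N)) -
       expansion_value q (\<lambda>i. coded_digits q p b' (i + N))) / q ^ N"
    by (simp add: diff_divide_distrib)
  moreover have "1 / (q * (q - 1)) / q ^ N \<le> (expansion_value q (\<lambda>i. coded_digits q p b (i + N)) -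
       expansion_value q (\<lambda>i. coded_digits q p b' (i + N))) / q ^ N"
    using tails q by (intro divide_right_mono) auto
  ultimately show ?thesis by (simp add: N_def)
qed

text \<open>One bit costs \<open>2 * Suc p\<close> digits, so the condition on \<open>s\<close> says
  that the scale of one bit, raised to the power \<open>s\<close>, shrinks no faster than its binary
  weight: decoding is Hoelder with exponent \<open>s\<close>.\<close>

lemma hausdorff_measure_U_set_pos:
  assumes q: "q > 2" and p: "1 / (q - 1) + 1 / q ^ p < q * (q - 2)"
    and s: "s > 0" "q powr (2 * real (Suc p) * s) \<le> 2"
  shows "hausdorff_measure s (U_set q) \<noteq> 0"
proof -
  define X where "X = (\<lambda>b. expansion_value q (coded_digits q p b))"
  define \<delta> where "\<delta> = 1 / (q * (q - 1))"
  \<comment> \<open>\<delta> is the gap from \<open>coded_digits_separation\<close>; the 2 pays for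
    the half block of \<open>Suc p\<close> digits in front of the differing bit.\<close>
  define C where "C = 2 / \<delta> powr s"
  have "\<delta> > 0" using q by (simp add: \<delta>_def)
  have C: "C > 0" using \<open>\<delta> > 0\<close> by (simp add: C_def)
  have key: "\<bar>binary_value b - binary_value b'\<bar> \<le> C * dist (X b) (X b') powr s"
    if agree: "\<And>i. i < j \<Longrightarrow> b i = b' i" and differ: "b j" "\<not> b' j" for b b' j
  proof -
    define N where "N = Suc p * (2 * j + 1)"
    \<comment> \<open>\<open>N\<close> consists of \<open>j\<close> blocks of
      \<open>2 * Suc p\<close> digits and a half block; each contributes a factor of at most 2 to
      \<open>q powr (real N * s)\<close>.\<close>
    have N: "real N * s = (2 * real (Suc p) * s) * real j + real (Suc p) * s"
      by (simp add: N_def algebra_simps)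
    have "q powr (real N * s) = (q powr (2 * real (Suc p) * s)) ^ j * q powr (real (Suc p) * s)"
      unfolding N powr_add using q by (simp add: powr_powr powr_realpow[symmetric])
    also have "\<dots> \<le> 2 ^ j * 2"
    proof (intro mult_mono power_mono)
      have "q powr (real (Suc p) * s) \<le> q powr (2 * real (Suc p) * s)"
        using q s(1) by (intro powr_mono) auto
      then show "q powr (real (Suc p) * s) \<le> 2" using s(2) by linarith
    qed (use s(2) in auto)
    finally have qN: "q powr (real N * s) \<le> 2 ^ j * 2" .
    have "\<bar>binary_value b - binary_value b'\<bar> \<le> 1 / 2 ^ j"
      using agree by (rule binary_value_diff)
    also have "\<dots> \<le> 2 / q powr (real N * s)"
      using qN q by (simp add: field_simps)
    also have "\<dots> = C * (\<delta> / q ^ N) powr s"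
      using \<open>\<delta> > 0\<close> q by (simp add: C_def powr_divide powr_realpow[symmetric] powr_powr)
    also have "\<dots> \<le> C * dist (X b) (X b') powr s"
    proof (intro mult_left_mono powr_mono2)
      have "\<delta> / q ^ N \<le> X b - X b'"
        using coded_digits_separation[OF q p, of j b b'] agree differ by (simp add: X_def \<delta>_def N_def)
      then show "\<delta> / q ^ N \<le> dist (X b) (X b')" by (simp add: dist_real_def)
    qed (use s C \<open>\<delta> > 0\<close> q in auto)
    finally show ?thesis .
  qed
  have "\<bar>binary_value b - binary_value b'\<bar> \<le> C * dist (X b) (X b') powr s" for b b'
  proof (cases "b = b'")
    case False
    then obtain m where "b m \<noteq> b' m" by blast
    define j where "j = (LEAST m. b m \<noteq> b' m)"
    have j: "b j \<noteq> b' j" unfolding j_def using \<open>b m \<noteq> b' m\<close> by (rule LeastI)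
    have agree: "b i = b' i" if "i < j" for i using not_less_Least that unfolding j_def by blast
    show ?thesis
    proof (cases "b j")
      case True
      then show ?thesis using key[of j b b'] agree j by blast
    next
      case False
      then show ?thesis using key[of j b' b] agree j
        by (simp add: dist_commute abs_minus_commute)
    qed
  qed (use C in simp)
  moreover have "range X \<subseteq> U_set q"
  proof -
    have "sparse q p (coded_digits q p b)" for b using q by (intro sparse_coded_digits) simp
    then have "unique_digits q (coded_digits q p b)" for b by (rule sparse_unique[OF q p])
    then show ?thesis by (auto simp: X_def U_set_eq_image)
  qed
  ultimately show ?thesis
    using s C range_binary_value by (intro hausdorff_measure_pos_if_hoelder_onto[of s C X])
qed

lemma hausdorff_dim_U_set_pos:
  assumes q: "q > 2" and crit: "q * (q - 1) * (q - 2) > 1"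
  shows "hausdorff_dim (U_set q) > 0"
proof -
  have "1 < q * (q - 2) * (q - 1)" using crit by (simp only: ac_simps)
  then have "1 / (q - 1) < q * (q - 2)" using q by (simp add: pos_divide_less_eq)
  \<comment> \<open>Supercriticality leaves room between \<open>1 / (q - 1)\<close> and
    \<open>q * (q - 2)\<close>, and small powers of \<open>1 / q\<close> fit into it.\<close>
  then obtain p where "(1 / q) ^ p < q * (q - 2) - 1 / (q - 1)"
    using real_arch_pow_inv[of "q * (q - 2) - 1 / (q - 1)" "1 / q"] q by auto
  then have p: "1 / (q - 1) + 1 / q ^ p < q * (q - 2)" by (simp add: power_divide)
  \<comment> \<open>The exponent at which \<open>q powr (2 * real (Suc p) * s)\<close> equals
    2.\<close>
  define s0 where "s0 = ln 2 / (2 * real (Suc p) * ln q)"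
  have "s0 > 0" using q by (simp add: s0_def)
  have ne: "U_set q \<noteq> {}"
    using sparse_unique[OF q p sparse_coded_digits[of q p "\<lambda>_. True"]] q
    unfolding U_set_eq_image by auto
  have "ennreal s0 \<le> hausdorff_dim (U_set q)"
    unfolding hausdorff_dim_def
  proof (rule INF_greatest)
    fix s assume s: "s \<in> {s. 0 \<le> s \<and> hausdorff_measure s (U_set q) = 0}"
    have "s \<noteq> 0" using s ne hausdorff_measure_0_zero_exponent by blast
    then have "s > 0" using s by simp
    have "s0 \<le> s"
    proof (rule ccontr)
      assume "\<not> s0 \<le> s"
      then have "2 * real (Suc p) * s * ln q \<le> 2 * real (Suc p) * s0 * ln q"
        using q by (intro mult_right_mono mult_left_mono) auto
      also have "\<dots> = s0 * (2 * real (Suc p) * ln q)" by (simp only: ac_simps)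
      also have "\<dots> = ln 2" using q by (simp add: s0_def del: of_nat_Suc)
      finally have "exp (2 * real (Suc p) * s * ln q) \<le> exp (ln 2)" by (simp only: exp_le_cancel_iff)
      then have "q powr (2 * real (Suc p) * s) \<le> 2" using q by (simp add: powr_def)
      then show False using hausdorff_measure_U_set_pos[OF q p \<open>s > 0\<close>] s by blast
    qed
    then show "ennreal s0 \<le> ennreal s" by (rule ennreal_leI)
  qed
  then show ?thesis using \<open>s0 > 0\<close> by (metis ennreal_less_zero_iff less_le_trans)
qed

section \<open>Points with exactly k expansions\<close>

context
  fixes q :: real
  assumes q: "q > 2"
begin

text \<open>The point has the expansion \<open>1 0\<close>, then \<open>m\<close> digits
  \<open>q\<close>, then that of \<open>y\<close>. Its first digit is 1 or 0; the choice 0 leaves a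
  uniquely expandable remainder, and the choice 1 leaves the point of the same form for
  \<open>m - 1\<close>. Each step thus adds one expansion.\<close>

lemma card_q_expansions_chain:
  assumes y: "y \<in> univoque_first_one q"
  shows "card (q_expansions q ((1 + ((\<lambda>y. 1 + y / q) ^^ m) y / q) / q)) = m + 2"
proof -
  have q1: "q > 1" using q by simp
  \<comment> \<open>\<open>z m\<close> prepends \<open>m\<close> digits \<open>q\<close> to
    \<open>y\<close>; these digits are forced, so \<open>z m\<close> keeps a unique
    expansion.\<close>
  define z where "z = (\<lambda>m. ((\<lambda>y. 1 + y / q) ^^ m) y)"
  have z_Suc: "z (Suc m) = 1 + z m / q" for m by (simp add: z_def)
  obtain d where d: "unique_digits q d" "y = expansion_value q d"
    using y by (auto simp: univoque_first_one_def)
  have y_bounds: "1 / (q - 1) < y" "y < 1"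
    using univoque_first_one_greater[OF q1 y q] univoque_first_one_less_1[OF q1 y q] by auto
  have z_gt: "1 / (q - 1) < z m" for m
  proof (induction m)
    case 0 then show ?case using y_bounds by (simp add: z_def)
  next
    case (Suc m)
    have "0 < 1 / (q - 1)" "1 / (q - 1) < 1" using q by simp_all
    moreover from this(1) Suc have "0 < z m" by linarith
    then have "0 < z m / q" using q by simp
    ultimately show ?case unfolding z_Suc by linarith
  qed
  have card_z: "card (q_expansions q (z m)) = 1" for m
  proof (induction m)
    case 0 then show ?case using d by (simp add: z_def unique_digits_def)
  next
    case (Suc m)
    then show ?case unfolding z_Suc q_expansions_forced_q[OF q1 z_gt q]
      by (simp add: card_image[OF inj_case_nat])
  qed
  have z_le: "z m \<le> q / (q - 1)" for m
    using q_expansions_bounds(2)[OF q1, of "z m"] card_z[of m] by force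
  define x where "x = (\<lambda>m. (1 + z m / q) / q)"
  \<comment> \<open>The digit 0 leaves \<open>z (Suc m)\<close>, the digit 1 leaves
    \<open>z m / q\<close>, and the digit \<open>q\<close> a negative number.\<close>
  have branch: "card (q_expansions q (x m)) =
      card (q_expansions q (z (Suc m))) + card (q_expansions q (z m / q))"
    if "finite (q_expansions q (z m / q))" for m
  proof -
    have qx: "q * x m = z (Suc m)" using q by (simp add: x_def z_Suc)
    have "z m / q \<le> q / (q - 1) / q" using z_le[of m] q by (intro divide_right_mono) auto
    also have "\<dots> = 1 / (q - 1)" using q by simp
    also have "\<dots> < q - 1"
    proof -
      have "1 < (q - 1) * (q - 1)" using q by (intro less_1_mult) auto
      then show ?thesis using q by (simp add: pos_divide_less_eq)
    qed
    finally have none: "q_expansions q (z (Suc m) - q) = {}"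
      using q_expansions_bounds(1)[OF q1, of "z (Suc m) - q"] by (fastforce simp: z_Suc)
    have "q_expansions q (x m) =
        case_nat 0 ` q_expansions q (z (Suc m)) \<union> case_nat 1 ` q_expansions q (z m / q)"
      by (subst q_expansions_unfold[OF q1]) (simp add: qx none, simp add: z_Suc)
    also have "card \<dots> = card (case_nat 0 ` q_expansions q (z (Suc m)) :: (nat \<Rightarrow> real) set) +
        card (case_nat 1 ` q_expansions q (z m / q) :: (nat \<Rightarrow> real) set)"
    proof (intro card_Un_disjoint finite_imageI that)
      show "finite (q_expansions q (z (Suc m)))" using card_z[of "Suc m"] by (intro card_ge_0_finite) simp
      show "case_nat 0 ` q_expansions q (z (Suc m)) \<inter> case_nat 1 ` q_expansions q (z m / q) = {}"
        by (auto dest!: fun_cong[where x = 0])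
    qed
    finally show ?thesis by (simp add: card_image[OF inj_case_nat])
  qed
  have "card (q_expansions q (x m)) = m + 2"
  proof (induction m)
    case 0
    \<comment> \<open>\<open>y < 1\<close> forces the 0 in front of \<open>y\<close>, so the chain
      starts with two expansions.\<close>
    have "card (q_expansions q (z 0 / q)) = 1"
      using q_expansions_forced_0[OF q1 y_bounds(2)] card_z[of 0]
      by (simp add: z_def card_image[OF inj_case_nat])
    then show ?case using branch[of 0] card_z[of "Suc 0"] card_ge_0_finite by fastforce
  next
    case (Suc m)
    \<comment> \<open>The identity \<open>0q = 10\<close> closes the recursion.\<close>
    have "z (Suc m) / q = x m" by (simp add: x_def z_Suc)
    then show ?case using branch[of "Suc m"] Suc card_z[of "Suc (Suc m)"]
      card_ge_0_finite[of "q_expansions q (x m)"] by simp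
  qed
  then show ?thesis by (simp add: x_def z_def)
qed

lemma hausdorff_measure_0_first_one_if_U_k:
  assumes "k \<ge> 2" "s > 0" "hausdorff_measure s (U_k k q) = 0"
  shows "hausdorff_measure s (univoque_first_one q) = 0"
proof -
  define m where "m = k - 2"
  have "\<exists>a. \<forall>y. ((\<lambda>y. 1 + y / q) ^^ m) y = a + y / q ^ m"
  proof (induction m)
    case (Suc m)
    then obtain a where "\<And>y. ((\<lambda>y. 1 + y / q) ^^ m) y = a + y / q ^ m" by blast
    then show ?case using q by (intro exI[of _ "1 + a / q"]) (simp add: add_divide_distrib mult.commute)
  qed (intro exI[of _ 0], simp)
  then obtain a where a: "\<And>y. ((\<lambda>y. 1 + y / q) ^^ m) y = a + y / q ^ m" by blast
  define c where "c = (1 + a / q) / q"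
  \<comment> \<open>Inverse of the similarity \<open>y \<mapsto> c + y / q ^ (m + 2)\<close> that
    prepends the word \<open>1 0\<close> and \<open>m\<close> digits \<open>q\<close>;
    \<open>c\<close> is the value of that word.\<close>
  define f where "f = (\<lambda>x. q ^ (m + 2) * (x - c))"
  have "univoque_first_one q \<subseteq> f ` U_k k q"
  proof
    fix y assume y: "y \<in> univoque_first_one q"
    let ?x = "(1 + ((\<lambda>y. 1 + y / q) ^^ m) y / q) / q"
    have card: "card (q_expansions q ?x) = k"
      using card_q_expansions_chain[OF y, of m] assms(1) by (simp add: m_def)
    then have "q_expansions q ?x \<noteq> {}" using assms(1) by auto
    then have "?x \<in> U_k k q" using card by (simp add: U_k_def E_set_def)
    moreover have "?x - c = y / q ^ (m + 2)"
      unfolding a c_def using q by (simp add: field_simps)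
    then have "f ?x = y" using q by (simp add: f_def)
    ultimately show "y \<in> f ` U_k k q" by (metis imageI)
  qed
  moreover have "hausdorff_measure s (f ` U_k k q) = 0"
    using q
    by (intro hausdorff_measure_0_lipschitz_image[OF assms(2) _ assms(3), of "q ^ (m + 2)"] lipschitz_onI)
      (auto simp: f_def dist_real_def abs_mult right_diff_distrib[symmetric] simp del: power_add)
  ultimately show ?thesis by (rule hausdorff_measure_0_mono[rotated])
qed

end

section \<open>The critical base and the comparison of dimensions\<close>

text \<open>The product equals 1 at \<open>q_c > 2\<close>, increases strictly beyond 2, and is
  nonpositive between 1 and 2.\<close>

lemma q_c_less_iff:
  assumes "q > 1" shows "q_c < q \<longleftrightarrow> q * (q - 1) * (q - 2) > 1"
proof -
  have "q_c ^ 3 - 3 * q_c ^ 2 + 2 * q_c - 1 = 0"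
    unfolding q_c_def by (rule theI'[OF q_c_ex1])
  then have root: "q_c * (q_c - 1) * (q_c - 2) = 1"
    by (simp add: algebra_simps power2_eq_square power3_eq_cube)
  have mono: "x * (x - 1) * (x - 2) < y * (y - 1) * (y - 2)" if "2 < x" "x < y" for x y :: real
    using that by (intro mult_strict_mono) auto
  have "q_c > 2" using q_c_approx(1) by simp
  show ?thesis
  proof (cases "q > 2")
    case True
    then show ?thesis using mono[of q_c q] mono[of q q_c] root \<open>q_c > 2\<close> by (cases q q_c rule: linorder_cases) auto
  next
    case False
    then have "q * (q - 1) * (q - 2) \<le> 0" using assms by (intro mult_nonneg_nonpos) auto
    then show ?thesis using False \<open>q_c > 2\<close> by auto
  qed
qed

lemma hausdorff_measure_0_U_set_if_first_one:
  assumes "q > 1" "s > 0" "hausdorff_measure s (univoque_first_one q) = 0"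
  shows "hausdorff_measure s (U_set q) = 0"
proof -
  have "hausdorff_measure s {0, q / (q - 1)} = 0"
    using hausdorff_measure_0_Un[of s "{0}" "{q / (q - 1)}"] assms(2)
    by (simp add: hausdorff_measure_0_singleton insert_commute)
  then have "hausdorff_measure s
      (\<Union>n. prefixed q n (univoque_first_one q \<union> {0, q / (q - 1)})) = 0"
    using assms
    by (intro hausdorff_measure_0_UN hausdorff_measure_0_prefixed hausdorff_measure_0_Un)
  then show ?thesis using U_set_subset_prefixed[OF assms(1)] by (rule hausdorff_measure_0_mono)
qed

lemma hausdorff_dim_U_set_eq_0:
  assumes "1 < q" "q \<le> q_c" shows "hausdorff_dim (U_set q) = 0"
  using assms q_c_less_iff[OF assms(1)] univoque_first_one_empty[OF assms(1)]
  by (intro hausdorff_dim_eq_0 hausdorff_measure_0_U_set_if_first_one)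
    (simp_all add: hausdorff_measure_0_empty)

lemma hausdorff_dim_U_k_le:
  assumes "q > 1" "k \<ge> 1" shows "hausdorff_dim (U_k k q) \<le> hausdorff_dim (U_set q)"
proof (rule hausdorff_dim_le)
  fix s :: real assume "s > 0" "hausdorff_measure s (U_set q) = 0"
  then have "hausdorff_measure s (\<Union>n. prefixed q n (U_set q)) = 0"
    by (intro hausdorff_measure_0_UN hausdorff_measure_0_prefixed)
  then show "hausdorff_measure s (U_k k q) = 0"
    using U_k_subset_prefixed[OF assms] by (rule hausdorff_measure_0_mono)
qed

theorem theorem2:
  shows "(\<forall>q::real. q > 1 \<longrightarrow> (hausdorff_dim (U_set q) > 0 \<longleftrightarrow> q > q_c)) \<and>
    (\<forall>k::nat. \<forall>q::real. k \<ge> 2 \<and> q \<in> B_set k \<longrightarrow>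
      hausdorff_dim (U_k k q) = hausdorff_dim (U_set q))"
proof (intro conjI allI impI)
  have large: "q > 2" if "q > q_c" for q using that q_c_approx(1) by simp
  fix q :: real assume q: "q > 1"
  show "hausdorff_dim (U_set q) > 0 \<longleftrightarrow> q > q_c"
    using hausdorff_dim_U_set_eq_0[OF q] hausdorff_dim_U_set_pos[OF large] q_c_less_iff[OF q]
    by (cases "q > q_c") auto
next
  fix k :: nat and q :: real assume "k \<ge> 2 \<and> q \<in> B_set k"
  then have k: "k \<ge> 2" and q: "q > 1" by (auto simp: B_set_def)
  have "hausdorff_dim (U_set q) \<le> hausdorff_dim (U_k k q)"
  \<comment> \<open>Up to \<open>q_c\<close> the left side is 0. Above it \<open>q > 2\<close>, so
    null sets pass from \<open>U_k k q\<close> to \<open>A\<close> by the chain construction and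
    from \<open>A\<close> to \<open>U_set q\<close> by the countable cover.\<close>
  proof (cases "q > q_c")
    case True
    then have "q > 2" using q_c_approx(1) by simp
    then show ?thesis
      using k q by (intro hausdorff_dim_le hausdorff_measure_0_U_set_if_first_one
        hausdorff_measure_0_first_one_if_U_k)
  qed (use hausdorff_dim_U_set_eq_0[OF q] in simp)
  then show "hausdorff_dim (U_k k q) = hausdorff_dim (U_set q)"
    using hausdorff_dim_U_k_le[OF q] k by (intro antisym) auto
qed

end
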